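(* For a positive integer $r$, let $\mathbb{S}_r$ denote the statement that for every integer $n\ge 1$, $$B_n \equiv \begin{cases} n+1 \pmod{2^r} & \text{if } n \text{ is even},\\ (-1)^{\frac{n-1}{2}}\, n \pmod{2^r} & \text{if } n \text{ is odd}.\end{cases}$$ Then $\mathbb{S}_r$ is true for $r=5$ (thus also for $r=1,2,3,4$) and false for $r=6$ (thus also for every integer $r>6$).
   Context: For each integer $n\ge 1$, let $A_n$ denote the number of different ways in which a $2n\times 2n$ chessboard can be covered with $2n^2$ dominoes such that each domino covers two adjacent squares (equivalently, the number of perfect matchings of the $2n\times 2n$ square lattice graph). Define $B_n>0$ by $A_n = 2^n B_n^2$. It is well known that $B_n$ is an integer. *)

theory Defs
  imports Complex_Main "HOL-Library.Disjoint_Sets" "HOL-Number_Theory.Cong"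
begin

definition chessboard :: "nat \<Rightarrow> (nat \<times> nat) set" where
  "chessboard m = {0..<m} \<times> {0..<m}"

definition adjacent :: "nat \<times> nat \<Rightarrow> nat \<times> nat \<Rightarrow> bool" where
  "adjacent s t \<longleftrightarrow>
     \<bar>int (fst s) - int (fst t)\<bar> + \<bar>int (snd s) - int (snd t)\<bar> = 1"

definition is_domino :: "(nat \<times> nat) set \<Rightarrow> bool" where
  "is_domino d \<longleftrightarrow> (\<exists>s t. d = {s, t} \<and> adjacent s t)"

definition domino_tilings :: "(nat \<times> nat) set \<Rightarrow> (nat \<times> nat) set set set" where
  "domino_tilings R = {T. partition_on R T \<and> (\<forall>d\<in>T. is_domino d)}"

definition A :: "nat \<Rightarrow> nat" where
  "A n = card (domino_tilings (chessboard (2 * n)))"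

definition B :: "nat \<Rightarrow> real" where
  "B n = (THE x. x > 0 \<and> real (A n) = 2 ^ n * x\<^sup>2)"

(* B n is a real number, so the congruence includes the claim that it is an integer. *)
definition S :: "nat \<Rightarrow> bool" where
  "S r \<longleftrightarrow> (\<forall>n\<ge>1. \<exists>b::int. real_of_int b = B n \<and>
     [b = (if even n then int n + 1 else (- 1) ^ ((n - 1) div 2) * int n)] (mod 2 ^ r))"

text \<open>The description defining \<open>B n\<close> is proper.\<close>

lemma A_pos: "A n > 0"
proof -
  let ?d = "\<lambda>(i, j). {(i, 2 * j), (i, Suc (2 * j))} :: (nat \<times> nat) set"
  let ?T = "?d ` ({0..<2 * n} \<times> {0..<n})"
  let ?C = "chessboard (2 * n)"
  have "partition_on ?C ?T"
  proof (rule partition_onI)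
    show "\<Union> ?T = ?C"
    proof
      show "\<Union> ?T \<subseteq> ?C"
      proof
        fix s assume "s \<in> \<Union> ?T"
        then obtain i j where "i < 2 * n" "j < n" "s = (i, 2 * j) \<or> s = (i, Suc (2 * j))"
          by force
        then show "s \<in> ?C" unfolding chessboard_def by auto
      qed
      show "?C \<subseteq> \<Union> ?T"
      proof
        fix s assume "s \<in> ?C"
        then obtain i j where s: "s = (i, j)" "i < 2 * n" "j < 2 * n"
          by (auto simp: chessboard_def)
        have "j = 2 * (j div 2) \<or> j = Suc (2 * (j div 2))" by presburger
        then have "s \<in> ?d (i, j div 2)" unfolding s(1) by simp
        moreover have "(i, j div 2) \<in> {0..<2 * n} \<times> {0..<n}" using s(2,3) by simp
        ultimately show "s \<in> \<Union> ?T" by blast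
      qed
    qed
  next
    fix p q assume "p \<in> ?T" "q \<in> ?T" "p \<noteq> q"
    then obtain x y where xy: "p = ?d x" "q = ?d y" by blast
    obtain i j k l where ijkl: "x = (i, j)" "y = (k, l)" by (metis surj_pair)
    have p: "p = ?d (i, j)" and q: "q = ?d (k, l)" using xy ijkl by simp_all
    have ne: "i \<noteq> k \<or> j \<noteq> l" using \<open>p \<noteq> q\<close> p q by blast
    have "2 * j \<noteq> Suc (2 * l)" "2 * l \<noteq> Suc (2 * j)" by presburger+
    then show "disjnt p q" using ne unfolding p q by (simp add: disjnt_def)
  next
    show "{} \<notin> ?T" by auto
  qed
  moreover have "\<forall>d\<in>?T. is_domino d"
  proof
    fix d assume "d \<in> ?T"
    then obtain i j where d: "d = {(i, 2 * j), (i, Suc (2 * j))}" by auto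
    have "adjacent (i, 2 * j) (i, Suc (2 * j))" by (simp add: adjacent_def)
    then show "is_domino d" unfolding is_domino_def d by blast
  qed
  ultimately have "?T \<in> domino_tilings ?C" by (simp add: domino_tilings_def)
  moreover have "domino_tilings ?C \<subseteq> Pow (Pow ?C)"
    by (auto simp: domino_tilings_def partition_on_def)
  then have "finite (domino_tilings ?C)"
    by (rule finite_subset) (simp add: chessboard_def)
  ultimately show ?thesis unfolding A_def by (auto simp: card_gt_0_iff)
qed

lemma B_ex1: "\<exists>!x. x > 0 \<and> real (A n) = 2 ^ n * x\<^sup>2"
proof
  show "sqrt (real (A n) / 2 ^ n) > 0 \<and> real (A n) = 2 ^ n * (sqrt (real (A n) / 2 ^ n))\<^sup>2"
    using A_pos[of n] by simp
next
  fix x assume "x > 0 \<and> real (A n) = 2 ^ n * x\<^sup>2"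
  then show "x = sqrt (real (A n) / 2 ^ n)" by simp
qed

end

theory Submission imports Defs "Jordan_Normal_Form.Char_Poly" begin

text \<open>
  Write \<open>m = 2 n + 1\<close> and \<open>\<mu>\<^sub>k = 4 cos\<^sup>2 (\<pi> k / m)\<close>.  Kasteleyn's method turns the number of
  tilings into a determinant: with suitable signs on the edges of the square lattice, all perfect
  matchings contribute with the same sign to the determinant of the black-white adjacency matrix.
  Here the signs are verified by tiling the board square by square in row-major order and expanding
  the determinant along the same square: at each stage the squares already used fill everything
  before the current one and part of the next \<open>2 n\<close> squares, so a parity count determines the sign
  of a vertical domino from its position alone (\<open>sorted_minor_eq_tilings_count\<close>).  Products of
  sine waves diagonalise the square of the skew-symmetric matrix of the whole board, which gives
  \<open>A\<^sub>n\<^sup>4 = \<Prod> (\<mu>\<^sub>k + \<mu>\<^sub>l)\<close> over all \<open>1 \<le> k, l \<le> 2 n\<close> (\<open>tilings_fourth_power\<close>).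

  In this product the terms with \<open>l = k\<close> or \<open>l = m - k\<close> account for \<open>2\<^sup>4\<^sup>n\<close>, and the others are
  permuted by \<open>(k, l) \<mapsto> (k + l, k - l)\<close> modulo \<open>m\<close>.  By the addition theorem this permutation
  rewrites \<open>B\<^sub>n\<close> as \<open>\<Prod> (1 + t\<^sub>s t\<^sub>s') / 2\<close> over \<open>1 \<le> s < s' \<le> n\<close>, where \<open>t\<^sub>s = - tan\<^sup>2 (\<pi> s / m)\<close>
  (\<open>B_eq_tangent_product\<close>).  Put \<open>r = (1 - t\<^sub>s t\<^sub>s') / 4\<close>; then \<open>B\<^sub>n = \<Prod> (1 - 2 r)\<close>, so that \<open>B\<^sub>n\<close> is
  the value at \<open>2\<close> of the polynomial \<open>\<Prod> (1 - r x)\<close>.  Its coefficients \<open>c\<^sub>k\<close> are integers: each \<open>r\<close>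
  is an algebraic integer, since \<open>(1 - t\<^sub>s) / 4\<close> lies in \<open>\<int>[\<zeta>]\<close> for a primitive \<open>m\<close>-th root of unity
  \<open>\<zeta>\<close>, and Newton's identities express the \<open>c\<^sub>k\<close> rationally through the power sums of the \<open>t\<^sub>s\<close>,
  whose elementary symmetric functions are the binomial coefficients \<open>C(m, 2 l)\<close> up to sign.

  Hence \<open>B\<^sub>n \<equiv> c\<^sub>0 + 2 c\<^sub>1 + 4 c\<^sub>2 + 8 c\<^sub>3 + 16 c\<^sub>4\<close> modulo \<open>32\<close>.  The same identities show that \<open>c\<^sub>k\<close> is
  a polynomial in \<open>n\<close> of degree at most \<open>4 k\<close>.  On each residue class of \<open>n\<close> modulo \<open>4\<close> the claimed
  value is linear in \<open>n\<close>, so the difference of the two sides, divided by \<open>32\<close>, is a polynomial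
  of degree at most \<open>16\<close> in \<open>n div 4\<close>; it takes integral values everywhere as soon as it does so at
  the \<open>17\<close> points \<open>0, \<dots>, 16\<close>.  This leaves the \<open>68\<close> cases \<open>n < 68\<close>, which are computed.  Finally
  \<open>B\<^sub>3 = 29\<close> is not congruent to \<open>-3\<close> modulo \<open>64\<close>.
\<close>

section \<open>Domino tilings, square by square\<close>

lemma adjacent_commute: "adjacent s t \<longleftrightarrow> adjacent t s"
  by (auto simp: adjacent_def)

lemma finite_domino_tilings: "finite R \<Longrightarrow> finite (domino_tilings R)"
  by (rule finite_subset[of _ "Pow (Pow R)"]) (auto simp: domino_tilings_def partition_on_def)

lemma domino_tilings_empty: "domino_tilings {} = {{}}"
  by (auto simp: domino_tilings_def partition_on_def)

text \<open>The domino covering \<open>s\<close> is removed; it is determined by the other square \<open>t\<close> that it covers.\<close>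
lemma card_domino_tilings_rec:
  assumes "finite R" "s \<in> R"
  shows "card (domino_tilings R) =
    (\<Sum>t | t \<in> R \<and> adjacent s t. card (domino_tilings (R - {s, t})))"
proof -
  define U where "U t = insert {s, t} ` domino_tilings (R - {s, t})" for t
  have notin: "{s, t} \<notin> T" if "T \<in> domino_tilings (R - {s, t})" for t T
    using that unfolding domino_tilings_def partition_on_def by auto
  have eq: "domino_tilings R = (\<Union>t\<in>{t. t \<in> R \<and> adjacent s t}. U t)"
  proof (intro equalityI subsetI)
    fix T assume T: "T \<in> domino_tilings R"
    then obtain d where d: "d \<in> T" "s \<in> d"
      using assms by (auto simp: domino_tilings_def partition_on_def)
    have "is_domino d" using T d by (simp add: domino_tilings_def)
    then obtain u v where uv: "d = {u, v}" "adjacent u v" unfolding is_domino_def by blast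
    obtain t where t: "d = {s, t}" "adjacent s t"
      using uv d(2) adjacent_commute by (metis insert_commute insertE singletonD)
    have part: "partition_on R (insert d (T - {d}))"
      using T d by (simp add: domino_tilings_def insert_absorb)
    have disj: "disjnt d (\<Union>(T - {d}))"
      using T d by (auto simp: domino_tilings_def partition_on_def disjoint_def disjnt_def)
    then have "partition_on (R - d) (T - {d})" "d \<subseteq> R"
      using part[unfolded partition_on_insert[OF disj]] by auto
    then have "T - {d} \<in> domino_tilings (R - {s, t})" "t \<in> R"
      using T t by (auto simp: domino_tilings_def)
    then have "T \<in> U t" using d t unfolding U_def by (metis insert_Diff rev_image_eqI)
    then show "T \<in> (\<Union>t\<in>{t. t \<in> R \<and> adjacent s t}. U t)"
      using t \<open>t \<in> R\<close> by blast
  next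
    fix T assume "T \<in> (\<Union>t\<in>{t. t \<in> R \<and> adjacent s t}. U t)"
    then obtain t T' where t: "t \<in> R" "adjacent s t" "T' \<in> domino_tilings (R - {s, t})"
      "T = insert {s, t} T'" unfolding U_def by blast
    have "disjnt {s, t} (\<Union>T')"
      using t by (auto simp: domino_tilings_def partition_on_def disjnt_def)
    then have "partition_on R (insert {s, t} T')"
      using t assms by (subst partition_on_insert) (auto simp: domino_tilings_def)
    moreover have "is_domino {s, t}" using t(2) unfolding is_domino_def by blast
    ultimately show "T \<in> domino_tilings R"
      using t by (auto simp: domino_tilings_def)
  qed
  have disj: "U t \<inter> U t' = {}" if "t \<noteq> t'" for t t'
  proof -
    have False if T: "T \<in> U t" "T \<in> U t'" for T
    proof -
      obtain T' where T': "T' \<in> domino_tilings (R - {s, t'})" "T = insert {s, t'} T'"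
        using T unfolding U_def by blast
      have "{s, t} \<in> T" using T unfolding U_def by blast
      moreover have "{s, t} \<noteq> {s, t'}" using \<open>t \<noteq> t'\<close> by (auto simp: doubleton_eq_iff)
      ultimately have "{s, t} \<in> T'" using T' by blast
      then show False using T'(1) by (auto simp: domino_tilings_def partition_on_def)
    qed
    then show ?thesis by blast
  qed
  have "card (domino_tilings R) = (\<Sum>t | t \<in> R \<and> adjacent s t. card (U t))"
    unfolding eq
    by (rule card_UN_disjoint) (use assms disj in \<open>auto simp: U_def finite_domino_tilings\<close>)
  also have "\<dots> = (\<Sum>t | t \<in> R \<and> adjacent s t. card (domino_tilings (R - {s, t})))"
    unfolding U_def
  proof (intro sum.cong refl)
    fix t
    show "card (insert {s, t} ` domino_tilings (R - {s, t})) = card (domino_tilings (R - {s, t}))"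
  proof (rule card_image, rule inj_onI)
    fix T T' assume *: "T \<in> domino_tilings (R - {s, t})" "T' \<in> domino_tilings (R - {s, t})"
      "insert {s, t} T = insert {s, t} T'"
    then show "T = T'" using notin[OF *(1)] notin[OF *(2)] by (simp add: insert_ident)
  qed
  qed
  finally show ?thesis .
qed

section \<open>Minors of an integer matrix on sets of indices\<close>

text \<open>
  Rows and columns are taken in increasing order.  The value \<open>0\<close> for sets of different size keeps the
  Laplace expansion below free of a side condition on the sizes; it also matches the number of
  tilings of a region with unequally many squares of the two colours.
\<close>

definition sorted_minor :: "(nat \<Rightarrow> nat \<Rightarrow> int) \<Rightarrow> nat set \<Rightarrow> nat set \<Rightarrow> int" where
  "sorted_minor a X Y =
    (if card X = card Y
     then det (mat (card X) (card Y) (\<lambda>(i, j). a (sorted_list_of_set X ! i) (sorted_list_of_set Y ! j)))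
     else 0)"

lemma sorted_list_of_set_delete_nth:
  fixes Y :: "nat set"
  assumes "finite Y" "j < card Y"
  shows "sorted_list_of_set (Y - {sorted_list_of_set Y ! j}) =
    take j (sorted_list_of_set Y) @ drop (Suc j) (sorted_list_of_set Y)"
proof -
  let ?ys = "sorted_list_of_set Y"
  let ?zs = "take j ?ys @ drop (Suc j) ?ys"
  have split: "take j ?ys @ ?ys ! j # drop (Suc j) ?ys = ?ys"
    using assms by (simp add: id_take_nth_drop[symmetric])
  have ds: "distinct ?ys" "sorted ?ys" "set ?ys = Y" using assms by auto
  have "distinct (take j ?ys @ ?ys ! j # drop (Suc j) ?ys)" unfolding split by (rule ds(1))
  then have zs: "distinct ?zs" "?ys ! j \<notin> set ?zs" by auto
  have "sorted (take j ?ys @ ?ys ! j # drop (Suc j) ?ys)" unfolding split by (rule ds(2))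
  then have "sorted ?zs" by (auto simp: sorted_append)
  have "set (take j ?ys @ ?ys ! j # drop (Suc j) ?ys) = Y" unfolding split by (rule ds(3))
  then have "Y - {?ys ! j} = set ?zs" using zs(2) by auto
  then show ?thesis
    using sorted_list_of_set.idem_if_sorted_distinct[of ?zs] zs(1) \<open>sorted ?zs\<close> by simp
qed

lemma card_less_sorted_list_of_set_nth:
  fixes Y :: "nat set"
  assumes "finite Y" "j < card Y"
  shows "card {y \<in> Y. y < sorted_list_of_set Y ! j} = j"
proof -
  let ?ys = "sorted_list_of_set Y"
  have sd: "sorted_wrt (<) ?ys" by simp
  have "{y \<in> Y. y < ?ys ! j} = (\<lambda>i. ?ys ! i) ` {..<j}"
  proof (intro equalityI subsetI)
    fix y assume y: "y \<in> {y \<in> Y. y < ?ys ! j}"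
    then have "y \<in> set ?ys" using assms by simp
    then obtain i where i: "i < card Y" "y = ?ys ! i"
      by (metis in_set_conv_nth sorted_list_of_set.length_sorted_key_list_of_set)
    have "i < j"
    proof (rule ccontr)
      assume "\<not> i < j"
      then have "?ys ! j \<le> ?ys ! i"
        using i assms by (intro sorted_nth_mono) auto
      then show False using y i by simp
    qed
    then show "y \<in> (\<lambda>i. ?ys ! i) ` {..<j}" using i by blast
  next
    fix y assume "y \<in> (\<lambda>i. ?ys ! i) ` {..<j}"
    then obtain i where i: "i < j" "y = ?ys ! i" by blast
    then have "?ys ! i < ?ys ! j" using sd assms by (intro sorted_wrt_nth_less[of "(<)"]) auto
    moreover have "?ys ! i \<in> Y"
      using i assms nth_mem[of i ?ys] by simp
    ultimately show "y \<in> {y \<in> Y. y < ?ys ! j}" using i by simp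
  qed
  moreover have "inj_on (\<lambda>i. ?ys ! i) {..<j}"
    using assms by (intro inj_on_nth) auto
  ultimately show ?thesis by (simp add: card_image)
qed

text \<open>
  Expansion along the first row.  The column of \<open>w\<close> has as many columns to its left as \<open>Y\<close> has
  elements below \<open>w\<close>, which is the source of the sign.
\<close>
lemma sorted_minor_Laplace:
  assumes "finite X" "finite Y" "X \<noteq> {}"
  shows "sorted_minor a X Y =
    (\<Sum>w\<in>Y. (-1) ^ card {y \<in> Y. y < w} * a (Min X) w * sorted_minor a (X - {Min X}) (Y - {w}))"
proof (cases "card X = card Y")
  case False
  have "card (X - {Min X}) \<noteq> card (Y - {w})" if "w \<in> Y" for w
    using False assms that
    by (metis Min_in card.remove)
  then show ?thesis using False by (simp add: sorted_minor_def)
next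
  case True
  define k where "k = card X"
  let ?xs = "sorted_list_of_set X"
  let ?ys = "sorted_list_of_set Y"
  let ?A = "mat k k (\<lambda>(i, j). a (?xs ! i) (?ys ! j))"
  have k: "k > 0" "card Y = k" "card X = k"
    using assms True by (auto simp: k_def card_gt_0_iff)
  have xs: "?xs = Min X # sorted_list_of_set (X - {Min X})"
    using assms by (simp add: sorted_list_of_set_nonempty)
  have entry: "(-1) ^ card {y \<in> Y. y < ?ys ! j} * a (Min X) (?ys ! j)
      * sorted_minor a (X - {Min X}) (Y - {?ys ! j}) = ?A $$ (0, j) * cofactor ?A 0 j"
    if j: "j < k" for j
  proof -
    have w: "?ys ! j \<in> Y" using j k assms nth_mem[of j ?ys] by simp
    have c: "card (X - {Min X}) = k - 1" "card (Y - {?ys ! j}) = k - 1"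
      using assms w k by auto
    have "mat_delete ?A 0 j = mat (k - 1) (k - 1)
        (\<lambda>(i, l). a (sorted_list_of_set (X - {Min X}) ! i) (sorted_list_of_set (Y - {?ys ! j}) ! l))"
      unfolding mat_delete_def using j k assms
      by (intro eq_matI)
        (auto simp: xs sorted_list_of_set_delete_nth nth_append)
    then have "sorted_minor a (X - {Min X}) (Y - {?ys ! j}) = det (mat_delete ?A 0 j)"
      unfolding sorted_minor_def c by simp
    then show ?thesis
      using j k assms by (simp add: cofactor_def card_less_sorted_list_of_set_nth xs)
  qed
  have "sorted_minor a X Y = det ?A"
    using True by (simp add: sorted_minor_def k_def)
  also have "\<dots> = (\<Sum>j<k. ?A $$ (0, j) * cofactor ?A 0 j)"
    using k by (intro laplace_expansion_row) auto
  also have "\<dots> = (\<Sum>j<k. (-1) ^ card {y \<in> Y. y < ?ys ! j} * a (Min X) (?ys ! j)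
      * sorted_minor a (X - {Min X}) (Y - {?ys ! j}))"
    by (rule sum.cong) (use entry in auto)
  also have "\<dots> = (\<Sum>w\<in>Y. (-1) ^ card {y \<in> Y. y < w} * a (Min X) w
      * sorted_minor a (X - {Min X}) (Y - {w}))"
  proof (rule sum.reindex_bij_betw)
    have "bij_betw ((!) ?ys) {..<length ?ys} (set ?ys)"
      by (rule bij_betw_nth) auto
    then show "bij_betw ((!) ?ys) {..<k} Y" using assms k by simp
  qed
  finally show ?thesis .
qed

lemma sorted_minor_transpose:
  assumes "\<And>x y. a y x = - a x y"
  shows "sorted_minor a Y X = (-1) ^ card X * sorted_minor a X Y"
proof (cases "card X = card Y")
  case True
  define k where "k = card X"
  let ?A = "mat k k (\<lambda>(i, j). a (sorted_list_of_set X ! i) (sorted_list_of_set Y ! j))"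
  have "mat k k (\<lambda>(i, j). a (sorted_list_of_set Y ! i) (sorted_list_of_set X ! j)) = (- 1) \<cdot>\<^sub>m ?A\<^sup>T"
    by (rule eq_matI) (auto intro: assms)
  then have "sorted_minor a Y X = det ((- 1) \<cdot>\<^sub>m ?A\<^sup>T)"
    using True by (simp add: sorted_minor_def k_def)
  also have "\<dots> = (- 1) ^ k * det ?A"
    by (simp add: det_smult det_transpose[of _ k])
  finally show ?thesis using True by (simp add: sorted_minor_def k_def)
qed (simp add: sorted_minor_def)

section \<open>Kasteleyn's signs\<close>

definition cell :: "nat \<Rightarrow> nat \<Rightarrow> nat \<times> nat" where
  "cell N c = (c div N, c mod N)"

text \<open>
  The squares of the \<open>N \<times> N\<close> board are numbered in row-major order.  Horizontal edges are oriented
  to the right; the orientation of a vertical edge alternates with the parity of its first end \<open>c\<close>.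
  For even \<open>N\<close> this is the parity of the column, and the product of the signs around each unit
  square of the lattice is that of a Kasteleyn orientation.
\<close>
definition kasteleyn :: "nat \<Rightarrow> nat \<Rightarrow> nat \<Rightarrow> int" where
  "kasteleyn N c d =
    (if d = Suc c \<and> d mod N \<noteq> 0 then 1
     else if c = Suc d \<and> c mod N \<noteq> 0 then - 1
     else if d = c + N then (-1) ^ Suc c
     else if c = d + N then - ((-1) ^ Suc d)
     else 0)"

lemma kasteleyn_skew:
  assumes "even N" "N > 0"
  shows "kasteleyn N d c = - kasteleyn N c d"
proof -
  have "N \<noteq> 1" using assms by auto
  consider "d = Suc c" | "c = Suc d" | "d = c + N" "d \<noteq> Suc c" | "c = d + N" "c \<noteq> Suc d"
    | "d \<noteq> Suc c" "c \<noteq> Suc d" "d \<noteq> c + N" "c \<noteq> d + N" by blast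
  then show ?thesis
    by cases (use assms \<open>N \<noteq> 1\<close> in \<open>simp_all add: kasteleyn_def\<close>)
qed

definition dark :: "nat \<Rightarrow> nat \<Rightarrow> bool" where
  "dark N c \<longleftrightarrow> even (c div N + c mod N)"

lemma adjacent_cell_iff:
  assumes "N > 0" "c < d"
  shows "adjacent (cell N c) (cell N d) \<longleftrightarrow> d = Suc c \<and> d mod N \<noteq> 0 \<or> d = c + N"
proof -
  define r q r' q' where "r = c div N" and "q = c mod N" and "r' = d div N" and "q' = d mod N"
  have c: "c = r * N + q" and d: "d = r' * N + q'" and q: "q < N" "q' < N"
    using assms by (auto simp: r_def q_def r'_def q'_def)
  have rr: "r \<le> r'" using assms by (auto simp: r_def r'_def intro: div_le_mono)
  have "adjacent (cell N c) (cell N d) \<longleftrightarrow> \<bar>int r - int r'\<bar> + \<bar>int q - int q'\<bar> = 1"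
    by (simp add: adjacent_def cell_def r_def q_def r'_def q'_def)
  also have "\<dots> \<longleftrightarrow> r' = r \<and> q' = Suc q \<or> r' = Suc r \<and> q' = q"
  proof
    assume *: "\<bar>int r - int r'\<bar> + \<bar>int q - int q'\<bar> = 1"
    have "r = r' \<Longrightarrow> q < q'" using assms c d by simp
    then show "r' = r \<and> q' = Suc q \<or> r' = Suc r \<and> q' = q" using * rr by linarith
  qed auto
  also have "\<dots> \<longleftrightarrow> d = Suc c \<and> d mod N \<noteq> 0 \<or> d = c + N"
  proof
    assume "r' = r \<and> q' = Suc q \<or> r' = Suc r \<and> q' = q"
    moreover have "d mod N = q'" by (simp add: q'_def)
    ultimately show "d = Suc c \<and> d mod N \<noteq> 0 \<or> d = c + N"
      using c d by auto
  next
    assume "d = Suc c \<and> d mod N \<noteq> 0 \<or> d = c + N"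
    then show "r' = r \<and> q' = Suc q \<or> r' = Suc r \<and> q' = q"
    proof
      assume *: "d = Suc c \<and> d mod N \<noteq> 0"
      then have "q' = Suc q" "r' = r"
        unfolding q'_def r'_def q_def r_def
        by (metis mod_Suc, metis div_Suc)
      then show ?thesis by simp
    next
      assume "d = c + N"
      then have "q' = q" "r' = Suc r"
        unfolding q'_def r'_def q_def r_def using assms by auto
      then show ?thesis by simp
    qed
  qed
  finally show ?thesis .
qed

lemma adjacent_dark:
  assumes "adjacent (cell N c) (cell N d)"
  shows "dark N c \<noteq> dark N d"
proof -
  have "even (x + y) \<noteq> even (x' + y')"
    if "\<bar>int x - int x'\<bar> + \<bar>int y - int y'\<bar> = 1" for x y x' y'
  proof -
    have "x = x' \<and> (y' = Suc y \<or> y = Suc y') \<or> y = y' \<and> (x' = Suc x \<or> x = Suc x')"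
      using that by linarith
    then show ?thesis by auto
  qed
  then show ?thesis
    using assms by (simp add: adjacent_def cell_def dark_def)
qed

lemma kasteleyn_eq_0:
  assumes "N > 0" "c < d" "\<not> adjacent (cell N c) (cell N d)"
  shows "kasteleyn N c d = 0"
  using assms by (auto simp: adjacent_cell_iff kasteleyn_def)

lemma inj_cell: "inj (cell N)"
proof (rule injI)
  fix c d assume "cell N c = cell N d"
  then have "c div N = d div N \<and> c mod N = d mod N" unfolding cell_def by blast
  then have "c div N * N + c mod N = d div N * N + d mod N" by (simp only:)
  then show "c = d" by (simp only: div_mult_mod_eq)
qed

definition tilings_count :: "nat \<Rightarrow> nat set \<Rightarrow> nat" where
  "tilings_count N R = card (domino_tilings (cell N ` R))"

lemma tilings_count_rec:
  assumes "finite R" "c \<in> R"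
  shows "tilings_count N R =
    (\<Sum>w | w \<in> R \<and> adjacent (cell N c) (cell N w). tilings_count N (R - {c, w}))"
proof -
  have img: "{t. t \<in> cell N ` R \<and> adjacent (cell N c) t} =
      cell N ` {w. w \<in> R \<and> adjacent (cell N c) (cell N w)}" by auto
  have "cell N ` R - {cell N c, cell N w} = cell N ` (R - {c, w})" for w
    by (simp add: image_set_diff[OF inj_cell])
  then show ?thesis
    unfolding tilings_count_def
    using card_domino_tilings_rec[of "cell N ` R" "cell N c"] assms
    by (simp add: img sum.reindex[OF inj_on_subset[OF inj_cell]])
qed

text \<open>
  Sorting the squares of each colour separately, as a minor does, changes the sign of a matching by
  the parity of the number of inversions between the two colours.  The triangular exponent in
  the sign \<open>shuffle_sign\<close> has increment \<open>k + 2\<close> when the size goes from \<open>k\<close> to \<open>k + 1\<close>; this is what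
  the removal of one domino requires.
\<close>
definition inversions :: "nat set \<Rightarrow> nat set \<Rightarrow> (nat \<times> nat) set" where
  "inversions X Y = {(x, y). x \<in> X \<and> y \<in> Y \<and> y < x}"

definition shuffle_sign :: "nat set \<Rightarrow> nat set \<Rightarrow> int" where
  "shuffle_sign X Y = (-1) ^ (card (inversions X Y) + card X * (card X + 3) div 2)"

lemma finite_inversions: "finite X \<Longrightarrow> finite Y \<Longrightarrow> finite (inversions X Y)"
  by (rule finite_subset[of _ "X \<times> Y"]) (auto simp: inversions_def)

lemma card_inversions_swap:
  assumes "finite X" "finite Y" "X \<inter> Y = {}"
  shows "card (inversions X Y) + card (inversions Y X) = card X * card Y"
proof -
  have "card (inversions Y X) = card (prod.swap ` inversions Y X)"
    by (simp add: card_image)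
  moreover have "X \<times> Y = inversions X Y \<union> prod.swap ` inversions Y X"
    "inversions X Y \<inter> prod.swap ` inversions Y X = {}"
    using assms unfolding inversions_def by (auto simp: image_iff linorder_neq_iff)
  ultimately show ?thesis
    using card_Un_disjoint[of "inversions X Y" "prod.swap ` inversions Y X"] assms
    by (metis card_cartesian_product finite_imageI finite_inversions)
qed

lemma minus_one_power_cong_even: "even (i + j) \<Longrightarrow> (-1 :: int) ^ i = (-1) ^ j"
  by (auto simp: minus_one_power_iff)

text \<open>
  Exchanging the colours changes a skew-symmetric minor by the same sign, so the peeling argument
  may assume that the first square belongs to the row set.
\<close>
lemma shuffle_sign_swap:
  assumes "finite X" "finite Y" "X \<inter> Y = {}" "card X = card Y"
  shows "shuffle_sign X Y = (-1) ^ card X * shuffle_sign Y X"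
proof -
  define k h where "k = card X" and "h = card X * (card X + 3) div 2"
  have "card (inversions X Y) + card (inversions Y X) = k * k"
    using card_inversions_swap[OF assms(1-3)] assms(4) by (simp add: k_def)
  then have "card (inversions X Y) + h + (k + (card (inversions Y X) + h)) = k * Suc k + 2 * h"
    by simp
  moreover have "even (k * Suc k + 2 * h)" by simp
  ultimately have "even (card (inversions X Y) + h + (k + (card (inversions Y X) + h)))"
    by metis
  then show ?thesis
    unfolding shuffle_sign_def assms(4)[symmetric] power_add[symmetric] k_def h_def
    by (rule minus_one_power_cong_even)
qed

text \<open>
  The sign picked up when a domino with first square \<open>c\<close> and second square \<open>w\<close> is removed: the first
  factor is the sign of the Laplace expansion, and the second depends only on the number of remaining
  squares before \<open>w\<close>, which is the part that the Kasteleyn weight has to cancel.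
\<close>
lemma shuffle_sign_remove:
  assumes fin: "finite X" "finite Y" and "X \<inter> Y = {}" "card X = card Y"
    and c: "c \<in> X" "\<And>z. z \<in> X \<union> Y \<Longrightarrow> c \<le> z" and w: "w \<in> Y"
  shows "shuffle_sign X Y = (-1) ^ card {y \<in> Y. y < w} * (-1) ^ Suc (card {z \<in> X \<union> Y. z < w})
    * shuffle_sign (X - {c}) (Y - {w})"
proof -
  obtain k where k: "card X = Suc k" "card (X - {c}) = k"
    using fin c by (metis card.remove)
  have "c < w" using c w assms(3) by (metis IntI UnI2 emptyE order_le_less)
  have inv: "inversions X Y = inversions (X - {c}) (Y - {w}) \<union> (\<lambda>x. (x, w)) ` {x \<in> X. w < x}"
    using c w \<open>c < w\<close> unfolding inversions_def by force
  have eq1: "card (inversions X Y) = card (inversions (X - {c}) (Y - {w})) + card {x \<in> X. w < x}"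
    unfolding inv using fin
    by (subst card_Un_disjoint) (auto simp: finite_inversions card_image inj_on_def, auto simp: inversions_def)
  have eq2: "card X = card {x \<in> X. x < w} + card {x \<in> X. w < x}"
  proof -
    have "X = {x \<in> X. x < w} \<union> {x \<in> X. w < x}" using w assms(3) by (auto simp: linorder_neq_iff)
    moreover have "{x \<in> X. x < w} \<inter> {x \<in> X. w < x} = {}" by auto
    ultimately show ?thesis
      using card_Un_disjoint[of "{x \<in> X. x < w}" "{x \<in> X. w < x}"] fin by simp
  qed
  have eq3: "card {z \<in> X \<union> Y. z < w} = card {x \<in> X. x < w} + card {y \<in> Y. y < w}"
  proof -
    have "{z \<in> X \<union> Y. z < w} = {x \<in> X. x < w} \<union> {y \<in> Y. y < w}" by auto
    then show ?thesis using fin assms(3) by (simp add: card_Un_disjoint disjoint_iff)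
  qed
  have eq4: "Suc k * (Suc k + 3) div 2 = k * (k + 3) div 2 + (k + 2)"
  proof -
    have "Suc k * (Suc k + 3) = k * (k + 3) + (k + 2) * 2" by (simp add: algebra_simps)
    then show ?thesis by (simp only: div_mult_self1)
  qed
  have "even (i + h + (b + Suc s + (i' + h')))"
    if "i = i' + m" "Suc k = l + m" "s = l + b" "h = h' + (k + 2)" for i i' m l s b h h'
    using that by presburger
  from this[OF eq1 eq2[unfolded k] eq3 eq4] show ?thesis
    unfolding shuffle_sign_def power_add[symmetric] k mult.assoc
    by (rule minus_one_power_cong_even)
qed

text \<open>
  Induction on the number of the first square \<open>c\<close> that may still be uncovered: all squares before \<open>c\<close>
  are covered, and all squares from \<open>c + N\<close> on are not.  If \<open>c\<close> is uncovered, then its domino ends at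
  \<open>c + 1\<close> or at \<open>c + N\<close>.  In the second case the number of uncovered squares before \<open>c + N\<close> has the
  parity of \<open>c\<close>, because the uncovered squares are even in number and so are the squares of the board.
  Thus the sign of every term of the expansion is the same as the sign of the whole minor.
\<close>
theorem sorted_minor_eq_tilings_count:
  assumes N: "even N" "N > 0"
  assumes "{c + N..<N * N} \<subseteq> X \<union> Y" "X \<union> Y \<subseteq> {c..<N * N}" "X \<inter> Y = {}"
    and "\<forall>x\<in>X. dark N x = p" "\<forall>y\<in>Y. dark N y = (\<not> p)"
  shows "sorted_minor (kasteleyn N) X Y = shuffle_sign X Y * int (tilings_count N (X \<union> Y))"
  using assms(3-)
proof (induction "N * N - c" arbitrary: c X Y p)
  case 0
  then have "{c..<N * N} = {}" by simp
  then have "X = {}" "Y = {}" using 0(3) by blast+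
  then show ?case
    by (simp add: sorted_minor_def shuffle_sign_def inversions_def tilings_count_def domino_tilings_empty)
next
  case (Suc l c X0 Y0 p0)
  have IH: "sorted_minor (kasteleyn N) X Y = shuffle_sign X Y * int (tilings_count N (X \<union> Y))"
    if "{Suc c + N..<N * N} \<subseteq> X \<union> Y" "X \<union> Y \<subseteq> {Suc c..<N * N}" "X \<inter> Y = {}"
      "\<forall>x\<in>X. dark N x = p" "\<forall>y\<in>Y. dark N y = (\<not> p)" for X Y p
    proof (rule Suc.hyps(1)[of "Suc c" X Y p])
    show "l = N * N - Suc c" using Suc.hyps(2) by linarith
  qed (use that in simp_all)
  have step: "sorted_minor (kasteleyn N) X Y = shuffle_sign X Y * int (tilings_count N (X \<union> Y))"
    if cX: "c \<in> X" and lo: "{c + N..<N * N} \<subseteq> X \<union> Y" and hi: "X \<union> Y \<subseteq> {c..<N * N}"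
      and disj: "X \<inter> Y = {}"
      and col: "\<forall>x\<in>X. dark N x = p" "\<forall>y\<in>Y. dark N y = (\<not> p)" for X Y p
  proof -
    have fin: "finite X" "finite Y"
      using hi by (meson finite_Un finite_atLeastLessThan finite_subset)+
    have Min: "Min X = c" using cX hi fin by (intro Min_eqI) auto
    let ?t = "\<lambda>w. tilings_count N (X \<union> Y - {c, w})"
    have IHw: "sorted_minor (kasteleyn N) (X - {c}) (Y - {w})
        = shuffle_sign (X - {c}) (Y - {w}) * int (?t w)"
      if w: "w \<in> Y" "adjacent (cell N c) (cell N w)" for w
    proof -
      have "c < w" using w(1) cX hi disj by (metis IntI Un_iff atLeastLessThan_iff empty_iff le_neq_implies_less subsetD)
      then have "w \<le> c + N" using w(2) N by (auto simp: adjacent_cell_iff)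
      have "X - {c} \<union> (Y - {w}) = X \<union> Y - {c, w}"
        using w(1) cX disj by auto
      moreover have "sorted_minor (kasteleyn N) (X - {c}) (Y - {w})
        = shuffle_sign (X - {c}) (Y - {w}) * int (tilings_count N (X - {c} \<union> (Y - {w})))"
      proof (rule IH[where p = p])
        show "{Suc c + N..<N * N} \<subseteq> X - {c} \<union> (Y - {w})"
        proof
          fix z assume z: "z \<in> {Suc c + N..<N * N}"
          then have "z \<in> {c + N..<N * N}" by simp
          then have "z \<in> X \<union> Y" using lo by blast
          then show "z \<in> X - {c} \<union> (Y - {w})" using z \<open>w \<le> c + N\<close> by auto
        qed
        show "X - {c} \<union> (Y - {w}) \<subseteq> {Suc c..<N * N}"
        proof
          fix z assume z: "z \<in> X - {c} \<union> (Y - {w})"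
          then have "z \<in> {c..<N * N}" "z \<noteq> c" using hi cX disj by auto
          then show "z \<in> {Suc c..<N * N}" by auto
        qed
        show "(X - {c}) \<inter> (Y - {w}) = {}" using disj by auto
      qed (use col in auto)
      ultimately show ?thesis by simp
    qed
    have nb: "{w. w \<in> X \<union> Y \<and> adjacent (cell N c) (cell N w)} = {w \<in> Y. adjacent (cell N c) (cell N w)}"
      using col cX adjacent_dark by blast
    have count: "tilings_count N (X \<union> Y) = (\<Sum>w | w \<in> Y \<and> adjacent (cell N c) (cell N w). ?t w)"
      using tilings_count_rec[of "X \<union> Y" c N] fin cX unfolding nb by simp
    show ?thesis
    proof (cases "card X = card Y")
      case False
      have "?t w = 0" if w: "w \<in> Y" "adjacent (cell N c) (cell N w)" for w
      proof -
        have "card (X - {c}) \<noteq> card (Y - {w})"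
          using False w(1) cX fin by (metis card.remove)
        then have "shuffle_sign (X - {c}) (Y - {w}) * int (?t w) = 0"
          using IHw[OF w] by (simp add: sorted_minor_def)
        then show ?thesis by (simp add: shuffle_sign_def)
      qed
      then have "tilings_count N (X \<union> Y) = 0" unfolding count by (intro sum.neutral) auto
      then show ?thesis using False by (simp add: sorted_minor_def)
    next
      case True
      have sign: "kasteleyn N c w = (-1) ^ Suc (card {z \<in> X \<union> Y. z < w})"
        if w: "w \<in> Y" "adjacent (cell N c) (cell N w)" for w
      proof -
        have "c < w" using w(1) cX hi disj by (metis IntI Un_iff atLeastLessThan_iff empty_iff le_neq_implies_less subsetD)
        then consider "w = Suc c" "w mod N \<noteq> 0" | "w = c + N" "w \<noteq> Suc c \<or> w mod N = 0"
          using w(2) N by (auto simp: adjacent_cell_iff)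
        then show ?thesis
        proof cases
          case 1
          have "{z \<in> X \<union> Y. z < w} = {c}" using 1 hi cX by auto
          then show ?thesis using 1 by (simp add: kasteleyn_def)
        next
          case 2
          have "w < N * N" using w(1) hi by auto
          have split: "X \<union> Y = {z \<in> X \<union> Y. z < w} \<union> {w..<N * N}"
            using lo hi 2 by auto
          have "card ({z \<in> X \<union> Y. z < w} \<union> {w..<N * N}) = card {z \<in> X \<union> Y. z < w} + card {w..<N * N}"
            using fin by (intro card_Un_disjoint) auto
          then have "card (X \<union> Y) = card {z \<in> X \<union> Y. z < w} + card {w..<N * N}"
            using split by argo
          moreover have "card (X \<union> Y) = 2 * card X"
            using fin disj True by (simp add: card_Un_disjoint)
          ultimately have "2 * card X = card {z \<in> X \<union> Y. z < w} + (N * N - w)" by simp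
          then have "2 * card X + w = card {z \<in> X \<union> Y. z < w} + N * N"
            using \<open>w < N * N\<close> by linarith
          then have "even (2 * card X + w) = even (card {z \<in> X \<union> Y. z < w} + N * N)" by simp
          then have "even w = even (card {z \<in> X \<union> Y. z < w})" using N by simp
          moreover have "even w = even c" using 2 N by simp
          ultimately have "(-1 :: int) ^ Suc (card {z \<in> X \<union> Y. z < w}) = (-1) ^ Suc c"
            by (intro minus_one_power_cong_even) simp
          moreover have "kasteleyn N c w = (-1) ^ Suc c"
            using 2 N unfolding kasteleyn_def by auto
          ultimately show ?thesis by simp
        qed
      qed
      have "sorted_minor (kasteleyn N) X Y = (\<Sum>w\<in>Y. (-1) ^ card {y \<in> Y. y < w} * kasteleyn N c w
          * sorted_minor (kasteleyn N) (X - {c}) (Y - {w}))"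
        using sorted_minor_Laplace[of X Y "kasteleyn N"] fin cX Min by auto
      also have "\<dots> = (\<Sum>w | w \<in> Y \<and> adjacent (cell N c) (cell N w).
          (-1) ^ card {y \<in> Y. y < w} * kasteleyn N c w
          * sorted_minor (kasteleyn N) (X - {c}) (Y - {w}))"
      proof (rule sum.mono_neutral_right)
        show "\<forall>w\<in>Y - {w \<in> Y. adjacent (cell N c) (cell N w)}. (-1) ^ card {y \<in> Y. y < w} * kasteleyn N c w
          * sorted_minor (kasteleyn N) (X - {c}) (Y - {w}) = 0"
        proof
          fix w assume w: "w \<in> Y - {w \<in> Y. adjacent (cell N c) (cell N w)}"
          then have "c < w" using cX hi disj by (metis DiffE IntI Un_iff atLeastLessThan_iff empty_iff le_neq_implies_less subsetD)
          then have "kasteleyn N c w = 0" using w N by (intro kasteleyn_eq_0) auto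
          then show "(-1) ^ card {y \<in> Y. y < w} * kasteleyn N c w
            * sorted_minor (kasteleyn N) (X - {c}) (Y - {w}) = 0" by simp
        qed
      qed (use fin in auto)
      also have "\<dots> = (\<Sum>w | w \<in> Y \<and> adjacent (cell N c) (cell N w). shuffle_sign X Y * int (?t w))"
      proof (intro sum.cong refl)
        fix w assume "w \<in> {w \<in> Y. adjacent (cell N c) (cell N w)}"
        then have w: "w \<in> Y" "adjacent (cell N c) (cell N w)" by auto
        have "shuffle_sign X Y = (-1) ^ card {y \<in> Y. y < w} * (-1) ^ Suc (card {z \<in> X \<union> Y. z < w})
            * shuffle_sign (X - {c}) (Y - {w})"
          using fin disj True cX w(1) hi by (intro shuffle_sign_remove) auto
        then show "(-1) ^ card {y \<in> Y. y < w} * kasteleyn N c w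
          * sorted_minor (kasteleyn N) (X - {c}) (Y - {w}) = shuffle_sign X Y * int (?t w)"
          unfolding IHw[OF w] sign[OF w] by simp
      qed
      also have "\<dots> = shuffle_sign X Y * int (tilings_count N (X \<union> Y))"
        unfolding count by (simp add: sum_distrib_left)
      finally show ?thesis .
    qed
  qed
  note hyps = Suc.prems
  consider "c \<in> X0" | "c \<in> Y0" | "c \<notin> X0 \<union> Y0" by blast
  then show ?case
  proof cases
    case 1
    then show ?thesis using step[OF 1 hyps] by simp
  next
    case 2
    have *: "sorted_minor (kasteleyn N) Y0 X0 = shuffle_sign Y0 X0 * int (tilings_count N (Y0 \<union> X0))"
    proof (rule step[where p = "\<not> p0"])
      show "c \<in> Y0" by (rule 2)
    qed (use hyps in \<open>auto simp: Un_commute Int_commute\<close>)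
    have **: "sorted_minor (kasteleyn N) X0 Y0 = (-1) ^ card Y0 * sorted_minor (kasteleyn N) Y0 X0"
      by (rule sorted_minor_transpose) (rule kasteleyn_skew[OF N])
    have fin: "finite X0" "finite Y0"
      using hyps(2) by (meson finite_Un finite_atLeastLessThan finite_subset)+
    show ?thesis
    proof (cases "card X0 = card Y0")
      case True
      have "shuffle_sign X0 Y0 = (-1) ^ card X0 * shuffle_sign Y0 X0"
        using fin hyps(3) True by (rule shuffle_sign_swap)
      then show ?thesis using * ** True by (simp add: Un_commute)
    next
      case False
      then show ?thesis using * by (auto simp: sorted_minor_def shuffle_sign_def Un_commute)
    qed
  next
    case 3
    show ?thesis
    proof (rule IH[where p = p0])
      have "{Suc c + N..<N * N} \<subseteq> {c + N..<N * N}" by auto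
      then show "{Suc c + N..<N * N} \<subseteq> X0 \<union> Y0" using hyps(1) by (rule order_trans)
      show "X0 \<union> Y0 \<subseteq> {Suc c..<N * N}"
      proof
        fix z assume z: "z \<in> X0 \<union> Y0"
        then have "z \<in> {c..<N * N}" "z \<noteq> c" using hyps(2) 3 by auto
        then show "z \<in> {Suc c..<N * N}" by auto
      qed
    qed (use hyps in auto)
  qed
qed

section \<open>The spectrum of the Kasteleyn matrix\<close>

text \<open>
  Indexing by lists of labels avoids permutation matrices: listing the dark squares before the
  light ones brings the matrix of the board into block form directly.
\<close>

definition list_mat :: "('a \<Rightarrow> 'b \<Rightarrow> 'c) \<Rightarrow> 'a list \<Rightarrow> 'b list \<Rightarrow> 'c mat" where
  "list_mat f xs ys = mat (length xs) (length ys) (\<lambda>(i, j). f (xs ! i) (ys ! j))"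

lemma list_mat_carrier [simp]: "list_mat f xs ys \<in> carrier_mat (length xs) (length ys)"
  by (simp add: list_mat_def)

lemma list_mat_mult:
  fixes f :: "'a \<Rightarrow> 'b \<Rightarrow> 'c :: semiring_0"
  assumes "distinct ys"
  shows "list_mat f xs ys * list_mat g ys zs = list_mat (\<lambda>x z. \<Sum>y\<in>set ys. f x y * g y z) xs zs"
proof -
  have "(\<Sum>y\<in>set ys. h y) = (\<Sum>i<length ys. h (ys ! i))" for h :: "'b \<Rightarrow> 'c"
    using sum.reindex_bij_betw[OF bij_betw_nth[OF assms refl refl], of h] by simp
  then show ?thesis
    by (intro eq_matI) (auto simp: list_mat_def scalar_prod_def atLeast0LessThan)
qed

lemma list_mat_cong:
  assumes "\<And>x y. x \<in> set xs \<Longrightarrow> y \<in> set ys \<Longrightarrow> f x y = g x y"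
  shows "list_mat f xs ys = list_mat g xs ys"
  using assms by (intro eq_matI) (auto simp: list_mat_def)

lemma det_list_mat_diag:
  fixes d :: "'a \<Rightarrow> 'c :: comm_ring_1"
  assumes "distinct xs"
  shows "det (list_mat (\<lambda>x y. if x = y then d y else 0) xs xs) = (\<Prod>x\<in>set xs. d x)"
proof -
  let ?D = "list_mat (\<lambda>x y. if x = y then d y else 0) xs xs"
  have "upper_triangular ?D"
    using assms by (auto simp: list_mat_def upper_triangular_def nth_eq_iff_index_eq)
  then have "det ?D = prod_list (diag_mat ?D)"
    by (rule det_upper_triangular[OF _ list_mat_carrier])
  also have "diag_mat ?D = map d xs"
    by (rule nth_equalityI) (auto simp: diag_mat_def list_mat_def)
  also have "prod_list (map d xs) = (\<Prod>x\<in>set xs. d x)"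
    using assms by (simp add: prod.distinct_set_conv_list)
  finally show ?thesis .
qed

lemma det_list_mat_scale_columns:
  fixes w :: "'a \<Rightarrow> 'a \<Rightarrow> 'c :: comm_ring_1"
  assumes "distinct xs"
  shows "det (list_mat (\<lambda>x e. d e * w x e) xs xs) = (\<Prod>x\<in>set xs. d x) * det (list_mat w xs xs)"
proof -
  have "list_mat (\<lambda>x e. d e * w x e) xs xs =
      list_mat w xs xs * list_mat (\<lambda>x y. if x = y then d y else 0) xs xs"
    unfolding list_mat_mult[OF assms]
    by (rule list_mat_cong) (simp add: if_distrib[of "\<lambda>z. _ * z"] sum.delta mult.commute cong: if_cong)
  then show ?thesis
    using det_mult[of "list_mat w xs xs" "length xs"] det_list_mat_diag[OF assms, of d] by simp
qed

text \<open>
  The square of a matrix with vanishing diagonal blocks is block diagonal, with the two products of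
  the off-diagonal blocks on its diagonal.
\<close>
lemma det_list_mat_bipartite_squared:
  fixes a :: "'a \<Rightarrow> 'a \<Rightarrow> 'c :: idom"
  assumes "distinct (xs @ ys)" "length xs = length ys"
    and xx: "\<And>x y. x \<in> set xs \<Longrightarrow> y \<in> set xs \<Longrightarrow> a x y = 0"
    and yy: "\<And>x y. x \<in> set ys \<Longrightarrow> y \<in> set ys \<Longrightarrow> a x y = 0"
  shows "det (list_mat a (xs @ ys) (xs @ ys)) ^ 2 = (det (list_mat a xs ys) * det (list_mat a ys xs)) ^ 2"
proof -
  define L where "L = xs @ ys"
  define k where "k = length xs"
  have k: "length xs = k" "length ys = k" using assms(2) by (auto simp: k_def)
  let ?F = "list_mat a L L" and ?K = "list_mat a xs ys" and ?K' = "list_mat a ys xs"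
  define G where "G x z = (\<Sum>y\<in>set L. a x y * a y z)" for x z
  have d: "distinct L" "distinct xs" "distinct ys" "set xs \<inter> set ys = {}"
    using assms(1) by (auto simp: L_def)
  have cK: "?K \<in> carrier_mat k k" "?K' \<in> carrier_mat k k"
    unfolding list_mat_def k by auto
  have cG: "list_mat G xs xs \<in> carrier_mat k k" "list_mat G ys ys \<in> carrier_mat k k"
    unfolding list_mat_def k by auto
  have split: "G x z = (\<Sum>y\<in>set xs. a x y * a y z) + (\<Sum>y\<in>set ys. a x y * a y z)" for x z
    unfolding G_def L_def set_append using d by (subst sum.union_disjoint) auto
  have "list_mat G xs xs = ?K * ?K'"
    unfolding list_mat_mult[OF d(3)] by (rule list_mat_cong) (simp add: split xx)
  moreover have "list_mat G ys ys = ?K' * ?K"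
    unfolding list_mat_mult[OF d(2)] by (rule list_mat_cong) (simp add: split yy)
  moreover have "?F * ?F = four_block_mat (list_mat G xs xs) (0\<^sub>m k k) (0\<^sub>m k k) (list_mat G ys ys)"
  proof (rule eq_matI)
    fix i j
    assume "i < dim_row (four_block_mat (list_mat G xs xs) (0\<^sub>m k k) (0\<^sub>m k k) (list_mat G ys ys))"
      and "j < dim_col (four_block_mat (list_mat G xs xs) (0\<^sub>m k k) (0\<^sub>m k k) (list_mat G ys ys))"
    then have ij: "i < k + k" "j < k + k" by (auto simp: list_mat_def k)
    have G0: "G x z = 0" if "x \<in> set xs \<and> z \<in> set ys \<or> x \<in> set ys \<and> z \<in> set xs" for x z
      using that by (auto simp: split xx yy)
    have mem: "i < k \<Longrightarrow> xs ! i \<in> set xs" "\<not> i < k \<Longrightarrow> ys ! (i - k) \<in> set ys"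
      "j < k \<Longrightarrow> xs ! j \<in> set xs" "\<not> j < k \<Longrightarrow> ys ! (j - k) \<in> set ys"
      using ij k by (auto intro!: nth_mem)
    have "(?F * ?F) $$ (i, j) = G (L ! i) (L ! j)"
      unfolding list_mat_mult[OF d(1)] G_def[symmetric]
      using ij by (simp add: list_mat_def L_def k)
    also have "\<dots> = four_block_mat (list_mat G xs xs) (0\<^sub>m k k) (0\<^sub>m k k) (list_mat G ys ys) $$ (i, j)"
      using ij mem by (auto simp: list_mat_def L_def k nth_append G0)
    finally show "(?F * ?F) $$ (i, j) =
      four_block_mat (list_mat G xs xs) (0\<^sub>m k k) (0\<^sub>m k k) (list_mat G ys ys) $$ (i, j)" .
  qed (auto simp: list_mat_def L_def k)
  ultimately have "det (?F * ?F) = det (?K * ?K') * det (?K' * ?K)"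
    using det_four_block_mat_upper_right_zero[OF cG(1) refl zero_carrier_mat cG(2)] by simp
  then show ?thesis
    using det_mult[OF list_mat_carrier list_mat_carrier, of a L a] det_mult[OF cK] det_mult[OF cK(2,1)]
    unfolding L_def power2_eq_square by (simp only: ac_simps)
qed

lemma bij_betw_div_mod:
  "bij_betw (\<lambda>c. (c div N, c mod N)) {..<N * N} ({..<N} \<times> {..<N :: nat})"
proof (cases "N = 0")
  case False
  show ?thesis
  proof (rule bij_betw_byWitness[where f' = "\<lambda>(r, q). r * N + q"])
    show "(\<lambda>(r, q). r * N + q) ` ({..<N} \<times> {..<N}) \<subseteq> {..<N * N}"
    proof clarsimp
      fix r q assume rq: "r < N" "q < N"
      have "r * N + q < Suc r * N" using rq by simp
      also have "\<dots> \<le> N * N" using rq by (intro mult_le_mono1) simp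
      finally show "r * N + q < N * N" .
    qed
  qed (use False in \<open>auto simp: less_mult_imp_div_less\<close>)
qed (simp add: bij_betw_def)

lemma sum_div_mod:
  fixes f :: "nat \<Rightarrow> nat \<Rightarrow> 'a :: comm_monoid_add"
  shows "(\<Sum>c<N * N. f (c div N) (c mod N)) = (\<Sum>r<N. \<Sum>q<N. f r q)"
  using sum.reindex_bij_betw[OF bij_betw_div_mod, of "\<lambda>(r, q). f r q"]
  by (simp add: sum.cartesian_product)

lemma prod_div_mod:
  fixes f :: "nat \<Rightarrow> nat \<Rightarrow> 'a :: comm_monoid_mult"
  shows "(\<Prod>c<N * N. f (c div N) (c mod N)) = (\<Prod>r<N. \<Prod>q<N. f r q)"
  using prod.reindex_bij_betw[OF bij_betw_div_mod, of "\<lambda>(r, q). f r q"]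
  by (simp add: prod.cartesian_product)

text \<open>The skew-symmetric adjacency matrix of a path.\<close>
definition step :: "nat \<Rightarrow> nat \<Rightarrow> complex" where
  "step i j = of_bool (j = Suc i) - of_bool (i = Suc j)"

text \<open>
  In coordinates the Kasteleyn matrix is \<open>1 \<otimes> J + J \<otimes> D\<close>, where \<open>J\<close> is the path matrix \<open>step\<close> and \<open>D\<close>
  is diagonal with alternating signs.  Since \<open>D\<close> anticommutes with \<open>J\<close>, the square of the sum has no
  mixed terms.
\<close>
lemma kasteleyn_coordinates:
  assumes "even N" "N > 0"
  shows "of_int (kasteleyn N c d) =
    of_bool (c div N = d div N) * step (c mod N) (d mod N)
    + (-1) ^ Suc (c mod N) * of_bool (c mod N = d mod N) * step (c div N) (d div N)"
proof -
  define r q r' q' where "r = c div N" and "q = c mod N" and "r' = d div N" and "q' = d mod N"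
  have q: "q < N" "q' < N" using assms by (auto simp: q_def q'_def)
  have c: "c = q + N * r" and d: "d = q' + N * r'"
    by (simp_all add: r_def q_def r'_def q'_def)
  have coord: "q + N * r = q' + N * r' \<longleftrightarrow> q = q' \<and> r = r'" if "q < N" "q' < N" for q q' r r'
    using that by (metis add.commute div_mult_self2 div_less add_0 mod_mult_self2 mod_less mult.commute less_nat_zero_code)
  have right: "d = Suc c \<and> d mod N \<noteq> 0 \<longleftrightarrow> r' = r \<and> q' = Suc q"
    if "d = q' + N * r'" "c = q + N * r" "q < N" "q' < N" for c d q q' r r'
  proof
    assume *: "d = Suc c \<and> d mod N \<noteq> 0"
    have "q' \<noteq> 0" using * that by auto
    then have "(q' - 1) + N * r' = q + N * r" "q' - 1 < N" using * that by auto
    then show "r' = r \<and> q' = Suc q" using coord[of "q' - 1" q r' r] that \<open>q' \<noteq> 0\<close> by auto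
  next
    assume "r' = r \<and> q' = Suc q"
    then show "d = Suc c \<and> d mod N \<noteq> 0" using that by auto
  qed
  have up: "d = c + N \<longleftrightarrow> r' = Suc r \<and> q' = q"
    if "d = q' + N * r'" "c = q + N * r" "q < N" "q' < N" for c d q q' r r'
    using coord[of q' q r' "Suc r"] that by auto
  have par: "even x \<longleftrightarrow> even q" if "x = q + N * r" for x q r
    using that assms(1) by simp
  have conds: "(d = Suc c \<and> d mod N \<noteq> 0) = (r' = r \<and> q' = Suc q)"
     "(c = Suc d \<and> c mod N \<noteq> 0) = (r = r' \<and> q = Suc q')"
     "(d = c + N) = (r' = Suc r \<and> q' = q)" "(c = d + N) = (r = Suc r' \<and> q = q')"
    using right[OF d c] right[OF c d] up[OF d c] up[OF c d] q by auto
  have sgn: "(-1 :: complex) ^ c = (-1) ^ q" "(-1 :: complex) ^ d = (-1) ^ q'"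
    using par[OF c] par[OF d] by (auto simp: minus_one_power_iff)
  show ?thesis
    unfolding kasteleyn_def conds
    unfolding r_def[symmetric] q_def[symmetric] r'_def[symmetric] q'_def[symmetric]
    by (auto simp: step_def sgn)
qed

definition angle :: "nat \<Rightarrow> nat \<Rightarrow> real" where
  "angle N k = pi * real (Suc k) / real (Suc N)"

text \<open>
  The factor \<open>\<i>\<^sup>i\<close> turns the discrete sine waves, which are eigenvectors of the symmetric adjacency
  matrix of a path, into eigenvectors of its skew-symmetric version.
\<close>
definition wave :: "nat \<Rightarrow> nat \<Rightarrow> nat \<Rightarrow> complex" where
  "wave N k i = \<i> ^ i * of_real (sin (angle N k * real (Suc i)))"

lemma sin_angle_end: "sin (angle N k * real (Suc N)) = 0"
proof -
  have "angle N k * real (Suc N) = real (Suc k) * pi" by (simp add: angle_def del: of_nat_Suc)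
  then show ?thesis by (simp only: sin_npi)
qed

lemma sin_three_term:
  fixes t :: real
  shows "sin (t * real (Suc (Suc j))) + sin (t * real j) = 2 * cos t * sin (t * real (Suc j))"
proof -
  have "t * real (Suc (Suc j)) = t * real (Suc j) + t" "t * real j = t * real (Suc j) - t"
    by (simp_all add: algebra_simps)
  then show ?thesis by (simp only: sin_add sin_diff) simp
qed

text \<open>
  The three-term recurrence of the sine holds at both ends of the path as well, because the wave
  vanishes at the two positions next to the ends.
\<close>
lemma step_wave:
  assumes "i < N"
  shows "(\<Sum>j<N. step i j * wave N k j) = 2 * \<i> * of_real (cos (angle N k)) * wave N k i"
proof -
  let ?s = "\<lambda>j. complex_of_real (sin (angle N k * real j))"
  have "(\<Sum>j<N. step i j * wave N k j) =
      (\<Sum>j<N. if j = Suc i then wave N k j else 0) - (\<Sum>j<N. if i = Suc j then wave N k j else 0)"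
    unfolding sum_subtractf[symmetric] by (rule sum.cong) (auto simp: step_def)
  also have "(\<Sum>j<N. if j = Suc i then wave N k j else 0) = \<i> ^ Suc i * ?s (Suc (Suc i))"
  proof (cases "Suc i = N")
    case True
    have "?s (Suc (Suc i)) = 0"
      unfolding True by (metis of_real_0 sin_angle_end)
    then show ?thesis using True by simp
  next
    case False
    then show ?thesis using assms by (simp add: sum.delta wave_def)
  qed
  also have "(\<Sum>j<N. if i = Suc j then wave N k j else 0) = - (\<i> ^ Suc i * ?s i)"
  proof (cases i)
    case (Suc i')
    then have "(\<Sum>j<N. if i = Suc j then wave N k j else 0) = (\<Sum>j<N. if j = i' then wave N k j else 0)"
      by (intro sum.cong) auto
    then show ?thesis using assms Suc by (simp add: sum.delta wave_def)
  qed simp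
  also have "\<i> ^ Suc i * ?s (Suc (Suc i)) - - (\<i> ^ Suc i * ?s i) =
      \<i> ^ Suc i * of_real (sin (angle N k * real (Suc (Suc i))) + sin (angle N k * real i))"
    by (simp add: algebra_simps)
  also have "\<dots> = 2 * \<i> * of_real (cos (angle N k)) * wave N k i"
    unfolding sin_three_term wave_def by simp
  finally show ?thesis .
qed

lemma step_alternating_wave:
  assumes "i < N"
  shows "(\<Sum>j<N. step i j * ((-1) ^ Suc j * wave N k j)) =
    - ((-1) ^ Suc i * (2 * \<i> * of_real (cos (angle N k)) * wave N k i))"
proof -
  have "(\<Sum>j<N. step i j * ((-1) ^ Suc j * wave N k j)) = (\<Sum>j<N. - ((-1) ^ Suc i) * (step i j * wave N k j))"
    by (rule sum.cong) (auto simp: step_def)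
  also have "\<dots> = - ((-1) ^ Suc i) * (\<Sum>j<N. step i j * wave N k j)"
    by (simp only: sum_distrib_left)
  finally show ?thesis unfolding step_wave[OF assms] by simp
qed

definition kasteleyn_op :: "nat \<Rightarrow> (nat \<Rightarrow> nat \<Rightarrow> complex) \<Rightarrow> nat \<Rightarrow> complex" where
  "kasteleyn_op N g c = (\<Sum>d<N * N. of_int (kasteleyn N c d) * g (d div N) (d mod N))"

lemma kasteleyn_op_coordinates:
  assumes "even N" "N > 0" "c < N * N"
  shows "kasteleyn_op N g c = (\<Sum>q<N. step (c mod N) q * g (c div N) q)
    + (-1) ^ Suc (c mod N) * (\<Sum>r<N. step (c div N) r * g r (c mod N))"
proof -
  define r0 q0 where "r0 = c div N" and "q0 = c mod N"
  have lt: "r0 < N" "q0 < N" using assms by (auto simp: r0_def q0_def less_mult_imp_div_less)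
  have "kasteleyn_op N g c = (\<Sum>d<N * N. (of_bool (r0 = d div N) * step q0 (d mod N)
    + (-1) ^ Suc q0 * of_bool (q0 = d mod N) * step r0 (d div N)) * g (d div N) (d mod N))"
    unfolding kasteleyn_op_def kasteleyn_coordinates[OF assms(1,2)] r0_def q0_def ..
  also have "\<dots> = (\<Sum>r<N. \<Sum>q<N. (of_bool (r0 = r) * step q0 q
    + (-1) ^ Suc q0 * of_bool (q0 = q) * step r0 r) * g r q)"
    by (rule sum_div_mod)
  also have "\<dots> = (\<Sum>r<N. \<Sum>q<N. (if r0 = r then step q0 q * g r q else 0))
     + (\<Sum>r<N. \<Sum>q<N. if q0 = q then (-1) ^ Suc q0 * step r0 r * g r q else 0)"
    unfolding sum.distrib[symmetric] by (intro sum.cong refl) (auto simp: algebra_simps)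
  also have "(\<Sum>r<N. \<Sum>q<N. (if r0 = r then step q0 q * g r q else 0)) = (\<Sum>q<N. step q0 q * g r0 q)"
    using lt by (subst sum.swap) (simp add: sum.delta')
  also have "(\<Sum>r<N. \<Sum>q<N. if q0 = q then (-1) ^ Suc q0 * step r0 r * g r q else 0)
      = (-1) ^ Suc q0 * (\<Sum>r<N. step r0 r * g r q0)"
    using lt by (simp add: sum.delta' sum_distrib_left ac_simps)
  finally show ?thesis unfolding r0_def q0_def .
qed

definition mode :: "nat \<Rightarrow> nat \<Rightarrow> nat \<Rightarrow> complex" where
  "mode N e c = wave N (e div N) (c div N) * wave N (e mod N) (c mod N)"

definition mode_value :: "nat \<Rightarrow> nat \<Rightarrow> real" where
  "mode_value N e = 4 * (cos (angle N (e div N)))\<^sup>2 + 4 * (cos (angle N (e mod N)))\<^sup>2"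

text \<open>
  One application of the matrix to a product of two waves gives a multiple of it and a multiple of its
  product with the alternating sign; in the second application the mixed terms cancel.
\<close>
lemma kasteleyn_square_mode:
  assumes N: "even N" "N > 0" and c: "c < N * N"
  shows "(\<Sum>d<N * N. of_int (kasteleyn N c d) *
      (\<Sum>d'<N * N. of_int (kasteleyn N d d') * mode N e d')) = - of_real (mode_value N e) * mode N e c"
proof -
  define k l where "k = e div N" and "l = e mod N"
  define x y where "x = 2 * \<i> * of_real (cos (angle N k))" and "y = 2 * \<i> * of_real (cos (angle N l))"
  have mult_sum: "(\<Sum>q<N. s q * (u * v q)) = u * (\<Sum>q<N. s q * v q)"
    "(\<Sum>q<N. s q * (v q * u)) = u * (\<Sum>q<N. s q * v q)" for s v :: "nat \<Rightarrow> complex" and u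
    by (simp_all add: sum_distrib_left ac_simps)
  have first: "(\<Sum>d'<N * N. of_int (kasteleyn N d d') * mode N e d') =
      y * mode N e d + x * ((-1) ^ Suc (d mod N) * mode N e d)" if d: "d < N * N" for d
  proof -
    have lt: "d div N < N" "d mod N < N" using N d by (auto simp: less_mult_imp_div_less)
    have "(\<Sum>d'<N * N. of_int (kasteleyn N d d') * mode N e d') =
        kasteleyn_op N (\<lambda>r q. wave N k r * wave N l q) d"
      by (simp add: kasteleyn_op_def mode_def k_def l_def)
    also have "\<dots> = wave N k (d div N) * (y * wave N l (d mod N))
        + (-1) ^ Suc (d mod N) * (wave N l (d mod N) * (x * wave N k (d div N)))"
      unfolding kasteleyn_op_coordinates[OF N d] mult_sum step_wave[OF lt(1)] step_wave[OF lt(2)]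
      by (simp add: x_def y_def)
    finally show ?thesis by (simp add: mode_def k_def l_def)
  qed
  have "(\<Sum>d<N * N. of_int (kasteleyn N c d) *
      (\<Sum>d'<N * N. of_int (kasteleyn N d d') * mode N e d')) =
      (\<Sum>d<N * N. of_int (kasteleyn N c d) * (y * mode N e d + x * ((-1) ^ Suc (d mod N) * mode N e d)))"
    by (intro sum.cong refl) (simp only: first lessThan_iff)
  also have "\<dots> = y * (\<Sum>d<N * N. of_int (kasteleyn N c d) * mode N e d)
      + x * (\<Sum>d<N * N. of_int (kasteleyn N c d) * ((-1) ^ Suc (d mod N) * mode N e d))"
    unfolding sum_distrib_left sum.distrib[symmetric]
    by (intro sum.cong refl) (simp add: algebra_simps)
  also have "(\<Sum>d<N * N. of_int (kasteleyn N c d) * ((-1) ^ Suc (d mod N) * mode N e d)) =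
      - ((-1) ^ Suc (c mod N)) * y * mode N e c + x * mode N e c"
  proof -
    have lt: "c div N < N" "c mod N < N" using N c by (auto simp: less_mult_imp_div_less)
    have "(\<Sum>d<N * N. of_int (kasteleyn N c d) * ((-1) ^ Suc (d mod N) * mode N e d)) =
        kasteleyn_op N (\<lambda>r q. wave N k r * ((-1) ^ Suc q * wave N l q)) c"
      unfolding kasteleyn_op_def mode_def k_def l_def by (intro sum.cong refl) (simp only: ac_simps)
    also have "\<dots> = wave N k (c div N) * (- ((-1) ^ Suc (c mod N) * (y * wave N l (c mod N))))
        + (-1) ^ Suc (c mod N) * (((-1) ^ Suc (c mod N) * wave N l (c mod N)) * (x * wave N k (c div N)))"
      unfolding kasteleyn_op_coordinates[OF N c] mult_sum step_wave[OF lt(1)] step_alternating_wave[OF lt(2)]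
      by (simp only: x_def y_def)
    finally show ?thesis by (simp add: mode_def k_def l_def)
  qed
  also have "y * (\<Sum>d<N * N. of_int (kasteleyn N c d) * mode N e d) +
      x * (- ((-1) ^ Suc (c mod N)) * y * mode N e c + x * mode N e c) = (y\<^sup>2 + x\<^sup>2) * mode N e c"
    unfolding first[OF c] by (simp add: algebra_simps power2_eq_square)
  also have "y\<^sup>2 + x\<^sup>2 = - of_real (mode_value N e)"
    by (simp add: x_def y_def mode_value_def k_def l_def power_mult_distrib)
  finally show ?thesis .
qed


text \<open>
  Waves for different frequencies are orthogonal because \<open>cos\<close> is injective on \<open>[0, \<pi>]\<close>: the difference
  of the eigenvalues times the inner product is a telescoping sum with vanishing ends.
\<close>
lemma wave_orthogonal:
  assumes "k < N" "l < N"
  shows "(\<Sum>i<N. cnj (wave N k i) * wave N l i) = 0 \<longleftrightarrow> k \<noteq> l"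
proof -
  let ?s = "\<lambda>k j. sin (angle N k * real j)"
  have "(\<Sum>i<N. cnj (wave N k i) * wave N l i) = (\<Sum>i<N. of_real (?s k (Suc i) * ?s l (Suc i)))"
  proof (intro sum.cong refl)
    fix i
    have "cnj (\<i> ^ i) * \<i> ^ i = 1"
      by (simp flip: power_mult_distrib)
    then have "(cnj (\<i> ^ i) * \<i> ^ i) * of_real (?s k (Suc i) * ?s l (Suc i)) = of_real (?s k (Suc i) * ?s l (Suc i))"
      by (simp only: mult_1_left)
    then show "cnj (wave N k i) * wave N l i = of_real (?s k (Suc i) * ?s l (Suc i))"
      unfolding wave_def complex_cnj_mult complex_cnj_complex_of_real of_real_mult by (simp only: ac_simps)
  qed
  then have eq: "(\<Sum>i<N. cnj (wave N k i) * wave N l i) = of_real (\<Sum>i<N. ?s k (Suc i) * ?s l (Suc i))"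
    by simp
  have "(\<Sum>i<N. ?s k (Suc i) * ?s l (Suc i)) = 0 \<longleftrightarrow> k \<noteq> l"
  proof (cases "k = l")
    case True
    have "0 < angle N k" "angle N k < pi"
      using assms by (auto simp: angle_def divide_less_eq)
    then have "0 < (?s k (Suc 0))\<^sup>2" using sin_gt_zero[of "angle N k"] by simp
    also have "\<dots> \<le> (\<Sum>i<N. (?s k (Suc i))\<^sup>2)"
      using assms by (intro member_le_sum) auto
    finally show ?thesis using True by (simp add: power2_eq_square)
  next
    case False
    define u where "u j = ?s k (Suc j) * ?s l j - ?s k j * ?s l (Suc j)" for j
    have diff: "2 * (cos (angle N k) - cos (angle N l)) * (?s k (Suc i) * ?s l (Suc i)) = u (Suc i) - u i" for i
    proof -
      have "2 * cos (angle N k) * ?s k (Suc i) = ?s k (Suc (Suc i)) + ?s k i"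
        "2 * cos (angle N l) * ?s l (Suc i) = ?s l (Suc (Suc i)) + ?s l i"
        by (rule sin_three_term[symmetric])+
      then have "2 * cos (angle N k) * ?s k (Suc i) * ?s l (Suc i) - 2 * cos (angle N l) * ?s l (Suc i) * ?s k (Suc i)
        = (?s k (Suc (Suc i)) + ?s k i) * ?s l (Suc i) - (?s l (Suc (Suc i)) + ?s l i) * ?s k (Suc i)"
        by (simp only:)
      then show ?thesis unfolding u_def by (simp only: algebra_simps)
    qed
    have "2 * (cos (angle N k) - cos (angle N l)) * (\<Sum>i<N. ?s k (Suc i) * ?s l (Suc i)) = u N - u 0"
      unfolding sum_distrib_left diff by (rule sum_lessThan_telescope)
    also have "u N = 0"
      unfolding u_def sin_angle_end by simp
    also have "u 0 = 0" by (simp add: u_def)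
    finally have "cos (angle N k) = cos (angle N l) \<or> (\<Sum>i<N. ?s k (Suc i) * ?s l (Suc i)) = 0" by simp
    moreover have "cos (angle N k) \<noteq> cos (angle N l)"
    proof
      assume "cos (angle N k) = cos (angle N l)"
      moreover have "0 \<le> angle N k" "angle N k \<le> pi" "0 \<le> angle N l" "angle N l \<le> pi"
        using assms by (auto simp: angle_def divide_le_eq)
      ultimately have "angle N k = angle N l" using cos_inj_pi by blast
      then show False using False by (simp add: angle_def)
    qed
    ultimately show ?thesis using False by simp
  qed
  then show ?thesis unfolding eq by (simp only: of_real_eq_0_iff)
qed

lemma mode_orthogonal:
  assumes "e < N * N" "e' < N * N"
  shows "(\<Sum>c<N * N. cnj (mode N e c) * mode N e' c) = 0 \<longleftrightarrow> e \<noteq> e'"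
proof -
  have "N > 0" using assms by (cases N) auto
  then have lt: "e div N < N" "e mod N < N" "e' div N < N" "e' mod N < N"
    using assms by (auto simp: less_mult_imp_div_less)
  have "(\<Sum>c<N * N. cnj (mode N e c) * mode N e' c) =
      (\<Sum>c<N * N. (\<lambda>r q. cnj (wave N (e div N) r) * wave N (e' div N) r *
        (cnj (wave N (e mod N) q) * wave N (e' mod N) q)) (c div N) (c mod N))"
    by (intro sum.cong refl) (simp add: mode_def)
  also have "\<dots> = (\<Sum>r<N. \<Sum>q<N. cnj (wave N (e div N) r) * wave N (e' div N) r *
        (cnj (wave N (e mod N) q) * wave N (e' mod N) q))"
    by (rule sum_div_mod)
  also have "\<dots> = (\<Sum>r<N. cnj (wave N (e div N) r) * wave N (e' div N) r) *
      (\<Sum>q<N. cnj (wave N (e mod N) q) * wave N (e' mod N) q)"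
    by (rule sum_product[symmetric])
  finally have "(\<Sum>c<N * N. cnj (mode N e c) * mode N e' c) = 0 \<longleftrightarrow>
      e div N \<noteq> e' div N \<or> e mod N \<noteq> e' mod N"
    by (simp add: wave_orthogonal lt)
  moreover have "e = e' \<longleftrightarrow> e div N = e' div N \<and> e mod N = e' mod N"
    by (metis div_mult_mod_eq)
  ultimately show ?thesis by blast
qed

lemma det_modes_nonzero:
  assumes "distinct L" "set L = {..<N * N}"
  shows "det (list_mat (\<lambda>c e. mode N e c) L L) \<noteq> 0"
proof
  assume 0: "det (list_mat (\<lambda>c e. mode N e c) L L) = 0"
  let ?n = "\<lambda>e. \<Sum>c<N * N. cnj (mode N e c) * mode N e c"
  have "list_mat (\<lambda>e c. cnj (mode N e c)) L L * list_mat (\<lambda>c e. mode N e c) L L =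
      list_mat (\<lambda>e e'. if e = e' then ?n e' else 0) L L"
    unfolding list_mat_mult[OF assms(1)] assms(2)
    by (rule list_mat_cong) (use mode_orthogonal assms(2) in auto)
  then have "(\<Prod>e\<in>set L. ?n e) = 0"
    using det_list_mat_diag[OF assms(1), of ?n] 0
      det_mult[OF list_mat_carrier list_mat_carrier, of "\<lambda>e c. cnj (mode N e c)" L "\<lambda>c e. mode N e c"]
    by simp
  then obtain e where "e \<in> set L" "?n e = 0" by auto
  then show False using mode_orthogonal[of e N e] assms(2) by simp
qed

text \<open>
  The modes form an invertible matrix of eigenvectors, so the determinant of the squared matrix is
  the product of its eigenvalues; the signs cancel since the number of squares is even.
\<close>
lemma det_kasteleyn_squared:
  assumes N: "even N" "N > 0" and L: "distinct L" "set L = {..<N * N}"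
  shows "(det (list_mat (\<lambda>c d. of_int (kasteleyn N c d) :: complex) L L))\<^sup>2 =
    of_real (\<Prod>e<N * N. mode_value N e)"
proof -
  let ?F = "list_mat (\<lambda>c d. of_int (kasteleyn N c d) :: complex) L L"
  let ?W = "list_mat (\<lambda>c e. mode N e c) L L"
  have "?F * (?F * ?W) = list_mat (\<lambda>c e. - of_real (mode_value N e) * mode N e c) L L"
    unfolding list_mat_mult[OF L(1)] L(2)
    by (rule list_mat_cong) (use kasteleyn_square_mode[OF N] L(2) in auto)
  then have "det (?F * (?F * ?W)) = (\<Prod>e<N * N. - of_real (mode_value N e)) * det ?W"
    using det_list_mat_scale_columns[OF L(1), of "\<lambda>e. - of_real (mode_value N e)" "\<lambda>c e. mode N e c"]
    unfolding L(2) by (simp only:)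
  moreover have "det (?F * (?F * ?W)) = det ?F * (det ?F * det ?W)"
    unfolding det_mult[OF list_mat_carrier mult_carrier_mat[OF list_mat_carrier list_mat_carrier]]
      det_mult[OF list_mat_carrier list_mat_carrier] ..
  ultimately have "(det ?F)\<^sup>2 = (\<Prod>e<N * N. - of_real (mode_value N e))"
    using det_modes_nonzero[OF L] by (simp add: power2_eq_square)
  also have "\<dots> = (\<Prod>e<N * N. of_real (mode_value N e))"
    using N by (subst prod_uminus) auto
  finally show ?thesis by simp
qed

text \<open>
  The determinant of the matrix of the whole board is, up to sign, the product of the
  dark-light and the light-dark minor, hence \<open>\<plusminus> A\<^sub>n\<^sup>2\<close>.
\<close>
theorem tilings_fourth_power:
  assumes "n > 0"
  shows "real (A n) ^ 4 = (\<Prod>k=1..2 * n. \<Prod>l=1..2 * n.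
    4 * (cos (pi * real k / real (2 * n + 1)))\<^sup>2 + 4 * (cos (pi * real l / real (2 * n + 1)))\<^sup>2)"
proof -
  define N where "N = 2 * n"
  have N: "even N" "N > 0" using assms by (auto simp: N_def)
  define X Y where "X = {c \<in> {..<N * N}. dark N c}" and "Y = {c \<in> {..<N * N}. \<not> dark N c}"
  have fin: "finite X" "finite Y" by (auto simp: X_def Y_def)
  have XY: "X \<union> Y = {..<N * N}" "X \<inter> Y = {}" by (auto simp: X_def Y_def)
  have "cell N ` {..<N * N} = chessboard N"
  proof (intro equalityI subsetI)
    fix s assume "s \<in> chessboard N"
    then obtain r q where rq: "s = (r, q)" "r < N" "q < N" by (auto simp: chessboard_def)
    have "r * N + q < Suc r * N" using rq by simp
    also have "\<dots> \<le> N * N" using rq by (intro mult_le_mono1) simp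
    finally have "r * N + q < N * N" .
    moreover have "cell N (r * N + q) = s" using rq by (simp add: cell_def)
    ultimately show "s \<in> cell N ` {..<N * N}" by blast
  qed (use N in \<open>auto simp: cell_def chessboard_def less_mult_imp_div_less\<close>)
  then have count: "tilings_count N (X \<union> Y) = A n" "tilings_count N (Y \<union> X) = A n"
    using XY by (simp_all add: tilings_count_def A_def N_def Un_commute)
  have dark: "\<forall>x\<in>X. dark N x = True" "\<forall>y\<in>Y. dark N y = (\<not> True)"
    "\<forall>y\<in>Y. dark N y = False" "\<forall>x\<in>X. dark N x = (\<not> False)" by (auto simp: X_def Y_def)
  have all: "{0 + N..<N * N} \<subseteq> {..<N * N}" "{..<N * N} \<subseteq> {0..<N * N}" by auto
  have minor: "sorted_minor (kasteleyn N) X Y = shuffle_sign X Y * int (A n)"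
    using sorted_minor_eq_tilings_count[OF N all[folded XY(1)] XY(2) dark(1,2)] count(1) by simp
  have "Y \<union> X = {..<N * N}" "Y \<inter> X = {}" using XY by auto
  then have minor': "sorted_minor (kasteleyn N) Y X = shuffle_sign Y X * int (A n)"
    using sorted_minor_eq_tilings_count[OF N _ _ _ dark(3,4), of 0] all count(2) by simp
  \<comment> \<open>Minors of non-square shape are \<open>0\<close> by convention, whereas the number of tilings is positive.\<close>
  have card: "card X = card Y"
  proof (rule ccontr)
    assume "card X \<noteq> card Y"
    then show False using minor A_pos[of n] by (simp add: sorted_minor_def shuffle_sign_def)
  qed
  let ?xs = "sorted_list_of_set X" and ?ys = "sorted_list_of_set Y"
  let ?a = "\<lambda>c d. of_int (kasteleyn N c d) :: complex"
  have det_minor: "det (list_mat ?a (sorted_list_of_set U) (sorted_list_of_set V)) =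
      of_int (sorted_minor (kasteleyn N) U V)" if "card U = card V" for U V
  proof -
    have "list_mat ?a (sorted_list_of_set U) (sorted_list_of_set V) =
      map_mat of_int (mat (card U) (card V) (\<lambda>(i, j). kasteleyn N (sorted_list_of_set U ! i) (sorted_list_of_set V ! j)))"
      by (rule eq_matI) (auto simp: list_mat_def)
    then show ?thesis using that by (simp add: sorted_minor_def)
  qed
  have "distinct (?xs @ ?ys)" using fin XY by auto
  have "of_real (\<Prod>e<N * N. mode_value N e) = (det (list_mat ?a (?xs @ ?ys) (?xs @ ?ys)))\<^sup>2"
    using \<open>distinct (?xs @ ?ys)\<close> fin XY by (intro det_kasteleyn_squared[OF N, symmetric]) auto
  also have "\<dots> = (det (list_mat ?a ?xs ?ys) * det (list_mat ?a ?ys ?xs)) ^ 2"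
  proof (rule det_list_mat_bipartite_squared)
    have same: "?a c d = 0" if "dark N c = dark N d" for c d
    proof -
      have "kasteleyn N c d = 0"
      proof (cases c d rule: linorder_cases)
        case less
        then show ?thesis using kasteleyn_eq_0[of N c d] adjacent_dark[of N c d] that N by blast
      next
        case greater
        then have "kasteleyn N d c = 0" using kasteleyn_eq_0[of N d c] adjacent_dark[of N d c] that N by blast
        then show ?thesis using kasteleyn_skew[OF N, of d c] by simp
      next
        case equal
        then show ?thesis using N by (simp add: kasteleyn_def)
      qed
      then show ?thesis by simp
    qed
    show "?a c d = 0" if "c \<in> set ?xs" "d \<in> set ?xs" for c d
      using that fin by (intro same) (simp add: X_def)
    show "?a c d = 0" if "c \<in> set ?ys" "d \<in> set ?ys" for c d
      using that fin by (intro same) (simp add: Y_def)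
  qed (use \<open>distinct (?xs @ ?ys)\<close> card in auto)
  also have "\<dots> = (of_int (shuffle_sign X Y * int (A n) * (shuffle_sign Y X * int (A n))))\<^sup>2"
    unfolding det_minor[OF card] det_minor[OF card[symmetric]] minor minor' by simp
  also have "\<dots> = of_real (real (A n) ^ 4)"
  proof -
    have "(shuffle_sign U V)\<^sup>2 = 1" for U V by (simp add: shuffle_sign_def flip: power_mult)
    then have "(shuffle_sign X Y * int (A n) * (shuffle_sign Y X * int (A n)))\<^sup>2 = int (A n) ^ 4"
      by (simp add: power_mult_distrib flip: power_mult power_add)
    then have "(of_int ((shuffle_sign X Y * int (A n) * (shuffle_sign Y X * int (A n)))\<^sup>2) :: complex)
       = of_int (int (A n) ^ 4)" by (simp only:)
    then show ?thesis by simp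
  qed
  finally have "real (A n) ^ 4 = (\<Prod>e<N * N. mode_value N e)"
    by (metis of_real_eq_iff)
  also have "\<dots> = (\<Prod>k<N. \<Prod>l<N. 4 * (cos (angle N k))\<^sup>2 + 4 * (cos (angle N l))\<^sup>2)"
    unfolding mode_value_def by (rule prod_div_mod)
  also have "\<dots> = (\<Prod>k=1..N. \<Prod>l=1..N.
    4 * (cos (pi * real k / real (2 * n + 1)))\<^sup>2 + 4 * (cos (pi * real l / real (2 * n + 1)))\<^sup>2)"
    unfolding angle_def by (simp add: N_def prod.atLeast1_atMost_eq add.commute)
  finally show ?thesis by (simp add: N_def)
qed

section \<open>A product of tangents\<close>

lemma sum_pair_up:
  fixes f :: "nat \<Rightarrow> 'a :: comm_monoid_add"
  shows "(\<Sum>k\<le>2 * n + 1. f k) = (\<Sum>l\<le>n. f (2 * l) + f (2 * l + 1))"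
  by (induction n) (simp_all add: add.assoc)

definition half_angle :: "nat \<Rightarrow> int \<Rightarrow> real" where
  "half_angle n s = pi * of_int s / real (2 * n + 1)"

lemma half_angle_add: "half_angle n (s + s') = half_angle n s + half_angle n s'"
  by (simp add: half_angle_def add_divide_distrib distrib_left)

lemma half_angle_diff: "half_angle n (s - s') = half_angle n s - half_angle n s'"
  by (simp add: half_angle_def diff_divide_distrib right_diff_distrib)

definition tangent :: "nat \<Rightarrow> int \<Rightarrow> real" where
  "tangent n s = - (tan (half_angle n s))\<^sup>2"

lemma half_angle_bounds:
  assumes "s \<in> {1..int n}"
  shows "0 < half_angle n s" "half_angle n s < pi / 2"
proof -
  show "0 < half_angle n s" using assms by (simp add: half_angle_def)
  have "2 * real_of_int s < real (2 * n + 1)" using assms by auto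
  then have "pi * (2 * real_of_int s) < pi * real (2 * n + 1)" by (intro mult_strict_left_mono) auto
  then show "half_angle n s < pi / 2" by (simp add: half_angle_def field_simps)
qed

lemma half_angle_sin_cos_pos:
  assumes "s \<in> {1..int n}"
  shows "sin (half_angle n s) > 0" "cos (half_angle n s) > 0"
  using half_angle_bounds[OF assms] by (auto intro!: sin_gt_zero cos_gt_zero_pi)

lemma cos_odd_multiple_expansion:
  "cos (real (2 * n + 1) * x) =
    (\<Sum>l\<le>n. real ((2 * n + 1) choose (2 * l)) * (-1) ^ l * sin x ^ (2 * l) * cos x ^ (2 * n + 1 - 2 * l))"
proof -
  let ?m = "2 * n + 1"
  have "cis (real ?m * x) = (\<i> * of_real (sin x) + of_real (cos x)) ^ ?m"
    unfolding DeMoivre[symmetric] by (intro arg_cong[of _ _ "\<lambda>z. z ^ ?m"]) (simp add: complex_eq_iff)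
  also have "\<dots> = (\<Sum>k\<le>?m. of_nat (?m choose k) * (\<i> * of_real (sin x)) ^ k * of_real (cos x) ^ (?m - k))"
    by (rule binomial_ring)
  also have "\<dots> = (\<Sum>l\<le>n. of_nat (?m choose (2 * l)) * (\<i> * of_real (sin x)) ^ (2 * l) * of_real (cos x) ^ (?m - 2 * l)
     + of_nat (?m choose (2 * l + 1)) * (\<i> * of_real (sin x)) ^ (2 * l + 1) * of_real (cos x) ^ (?m - (2 * l + 1)))"
    by (rule sum_pair_up)
  also have "\<dots> = (\<Sum>l\<le>n. of_real (real (?m choose (2 * l)) * (-1) ^ l * sin x ^ (2 * l) * cos x ^ (?m - 2 * l))
     + \<i> * of_real (real (?m choose (2 * l + 1)) * (-1) ^ l * sin x ^ (2 * l + 1) * cos x ^ (?m - (2 * l + 1))))"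
  proof (intro sum.cong refl)
    fix l
    have even: "(\<i> * z) ^ (2 * l) = (-1) ^ l * z ^ (2 * l)" for z
      by (simp only: power_mult_distrib power_mult[of \<i>] power2_i)
    have odd: "(\<i> * z) ^ (2 * l + 1) = \<i> * ((-1) ^ l * z ^ (2 * l + 1))" for z
      unfolding power_add even by simp
    show "of_nat (?m choose (2 * l)) * (\<i> * of_real (sin x)) ^ (2 * l) * of_real (cos x) ^ (?m - 2 * l)
     + of_nat (?m choose (2 * l + 1)) * (\<i> * of_real (sin x)) ^ (2 * l + 1) * of_real (cos x) ^ (?m - (2 * l + 1)) =
     of_real (real (?m choose (2 * l)) * (-1) ^ l * sin x ^ (2 * l) * cos x ^ (?m - 2 * l))
     + \<i> * of_real (real (?m choose (2 * l + 1)) * (-1) ^ l * sin x ^ (2 * l + 1) * cos x ^ (?m - (2 * l + 1)))"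
      unfolding even odd of_real_mult of_real_power of_real_of_nat_eq of_real_minus of_real_1
      by (simp only: ac_simps)
  qed
  finally have "Re (cis (real ?m * x)) = (\<Sum>l\<le>n. real (?m choose (2 * l)) * (-1) ^ l * sin x ^ (2 * l) * cos x ^ (?m - 2 * l))"
    by (simp only: Re_sum complex.sel plus_complex.sel Re_complex_of_real Re_i_times Im_complex_of_real minus_zero add_0_right)
  then show ?thesis by simp
qed

text \<open>
  With \<open>x = \<pi> / 2 - \<pi> s / m\<close> the expansion of \<open>cos (m x)\<close> vanishes, since \<open>m x\<close> is an odd multiple of
  \<open>\<pi> / 2\<close>; division by a power of \<open>sin (\<pi> s / m)\<close> leaves a polynomial in \<open>- cot\<^sup>2 (\<pi> s / m)\<close>.
\<close>
lemma tangent_root: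
  assumes "s \<in> {1..int n}"
  shows "(\<Sum>l\<le>n. real ((2 * n + 1) choose (2 * l)) * (inverse (tangent n s)) ^ l) = 0"
proof -
  let ?y = "half_angle n s" and ?m = "2 * n + 1"
  have pos: "sin ?y > 0" "cos ?y > 0" using half_angle_sin_cos_pos[OF assms] .
  have "real ?m * (pi / 2 - ?y) = real n * pi + pi / 2 - of_int s * pi"
    by (simp add: half_angle_def field_simps)
  also have "cos \<dots> = 0"
    by (simp add: cos_diff cos_add sin_add sin_npi_int mult.commute[of _ pi])
  finally have "0 = cos (real ?m * (pi / 2 - ?y))" by simp
  also have "\<dots> = (\<Sum>l\<le>n. real (?m choose (2 * l)) * (-1) ^ l * cos ?y ^ (2 * l) * sin ?y ^ (?m - 2 * l))"
    unfolding cos_odd_multiple_expansion by (simp add: sin_diff cos_diff)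
  also have "\<dots> = (\<Sum>l\<le>n. sin ?y ^ ?m * (real (?m choose (2 * l)) * (inverse (tangent n s)) ^ l))"
  proof (intro sum.cong refl)
    fix l assume "l \<in> {..n}"
    then have "sin ?y ^ ?m = sin ?y ^ (2 * l) * sin ?y ^ (?m - 2 * l)" by (simp flip: power_add)
    moreover have "inverse (tangent n s) = - ((cos ?y)\<^sup>2 / (sin ?y)\<^sup>2)"
      by (simp add: tangent_def tan_def power_divide)
    then have "inverse (tangent n s) ^ l = (-1) ^ l * cos ?y ^ (2 * l) / sin ?y ^ (2 * l)"
      by (simp add: power_minus[of "_ / _"] power_divide power_mult)
    ultimately show "real (?m choose (2 * l)) * (-1) ^ l * cos ?y ^ (2 * l) * sin ?y ^ (?m - 2 * l) =
        sin ?y ^ ?m * (real (?m choose (2 * l)) * (inverse (tangent n s)) ^ l)"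
      using pos by simp
  qed
  finally show ?thesis using pos by (simp add: sum_distrib_left[symmetric])
qed

lemma inj_tangent: "inj_on (tangent n) {1..int n}"
proof (rule inj_onI)
  fix s s' assume s: "s \<in> {1..int n}" "s' \<in> {1..int n}" "tangent n s = tangent n s'"
  have "tan (half_angle n s) > 0" "tan (half_angle n s') > 0"
    using s half_angle_bounds by (auto intro!: tan_gt_zero)
  then have "tan (half_angle n s) = tan (half_angle n s')"
    using s(3) by (simp add: tangent_def power2_eq_iff_nonneg)
  then have "arctan (tan (half_angle n s)) = arctan (tan (half_angle n s'))" by (simp only:)
  moreover have "arctan (tan (half_angle n u)) = half_angle n u" if "u \<in> {1..int n}" for u
    using half_angle_bounds[OF that] by (intro arctan_tan) auto
  ultimately have "half_angle n s = half_angle n s'"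
    using s(1,2) by metis
  then show "s = s'" by (simp add: half_angle_def field_simps)
qed

text \<open>
  Both sides have degree at most \<open>n\<close> and agree at \<open>0\<close> and at the \<open>n\<close> reciprocals of the \<open>t\<^sub>s\<close>.
\<close>
theorem prod_tangents:
  "(\<Prod>s\<in>{1..int n}. [:1, - tangent n s:]) = (\<Sum>l\<le>n. monom (real ((2 * n + 1) choose (2 * l))) l)"
proof -
  let ?roots = "(\<lambda>s. inverse (tangent n s)) ` {1..int n}"
  have nz: "tangent n s \<noteq> 0" if "s \<in> {1..int n}" for s
    using half_angle_sin_cos_pos[OF that] by (simp add: tangent_def tan_def)
  have inj: "inj_on (\<lambda>s. inverse (tangent n s)) {1..int n}"
    using inj_tangent[of n] by (auto simp: inj_on_def)
  have card: "card (insert 0 ?roots) = Suc n"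
    using card_image[OF inj] nz by (subst card_insert_disjoint) (auto simp: image_iff)
  show ?thesis
  proof (rule poly_eqI_degree[of "insert 0 ?roots"])
    fix x assume "x \<in> insert 0 ?roots"
    then consider "x = 0" | s where "s \<in> {1..int n}" "x = inverse (tangent n s)" by auto
    then show "poly (\<Prod>s\<in>{1..int n}. [:1, - tangent n s:]) x =
        poly (\<Sum>l\<le>n. monom (real ((2 * n + 1) choose (2 * l))) l) x"
    proof cases
      case 1
      have "(\<Sum>l\<le>n. real ((2 * n + 1) choose (2 * l)) * 0 ^ l) = (\<Sum>l\<le>n. if l = 0 then 1 else 0)"
        by (intro sum.cong) auto
      then show ?thesis using 1 by (simp add: poly_prod poly_sum poly_monom)
    next
      case 2
      have "(\<Prod>s'\<in>{1..int n}. 1 - x * tangent n s') = 0"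
        using 2 nz by (intro prod_zero bexI[of _ s]) auto
      then show ?thesis using 2 tangent_root[of s n] by (simp add: poly_prod poly_sum poly_monom)
    qed
  next
    have "degree (\<Prod>s\<in>{1..int n}. [:1, - tangent n s:]) \<le> (\<Sum>s\<in>{1..int n}. degree [:1, - tangent n s:])"
      using degree_prod_sum_le[of "{1..int n}" "\<lambda>s. [:1, - tangent n s:]"] by (simp add: o_def)
    also have "\<dots> \<le> (\<Sum>s\<in>{1..int n}. 1)" by (intro sum_mono) simp
    finally show "degree (\<Prod>s\<in>{1..int n}. [:1, - tangent n s:]) < card (insert 0 ?roots)"
      unfolding card by simp
    have "degree (\<Sum>l\<le>n. monom (real ((2 * n + 1) choose (2 * l))) l) \<le> n"
      by (rule degree_sum_le) (auto intro: order_trans[OF degree_monom_le])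
    then show "degree (\<Sum>l\<le>n. monom (real ((2 * n + 1) choose (2 * l))) l) < card (insert 0 ?roots)"
      unfolding card by simp
  qed
qed

text \<open>
  Since \<open>1 - t\<^sub>s = 1 / cos\<^sup>2 (\<pi> s / m)\<close>, this is the value of the previous polynomial at \<open>1\<close>, a sum of
  the binomial coefficients with even lower index.
\<close>
lemma prod_cos_squared: "(\<Prod>s\<in>{1..int n}. 4 * (cos (half_angle n s))\<^sup>2) = 1"
proof -
  have "(\<Prod>s\<in>{1..int n}. inverse ((cos (half_angle n s))\<^sup>2)) = (\<Prod>s\<in>{1..int n}. poly [:1, - tangent n s:] 1)"
  proof (intro prod.cong refl)
    fix s assume "s \<in> {1..int n}"
    then have "cos (half_angle n s) \<noteq> 0" using half_angle_sin_cos_pos by force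
    then show "inverse ((cos (half_angle n s))\<^sup>2) = poly [:1, - tangent n s:] 1"
      using tan_sec[of "half_angle n s"] by (simp add: tangent_def power_inverse)
  qed
  also have "\<dots> = (\<Sum>l\<le>n. real ((2 * n + 1) choose (2 * l)))"
    by (simp only: poly_prod[symmetric] prod_tangents poly_sum poly_monom power_one mult_1_right)
  also have "\<dots> = (\<Sum>k\<le>2 * n + 1. if even k then real ((2 * n + 1) choose k) else 0)"
    unfolding sum_pair_up by simp
  also have "\<dots> = 4 ^ n"
    using choose_even_sum[of "2 * n + 1", where 'a = real] by (simp add: power_mult)
  finally have "inverse (\<Prod>s\<in>{1..int n}. (cos (half_angle n s))\<^sup>2) = 4 ^ n"
    by (simp add: prod_inversef[symmetric] o_def)
  then have "(\<Prod>s\<in>{1..int n}. (cos (half_angle n s))\<^sup>2) = inverse (4 ^ n)"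
    by (metis inverse_inverse_eq)
  then show ?thesis by (simp add: prod.distrib)
qed

lemma prod_fold:
  fixes f :: "int \<Rightarrow> 'a :: comm_monoid_mult"
  assumes "\<And>k. k \<in> {1..int n} \<Longrightarrow> f (2 * int n + 1 - k) = f k"
  shows "(\<Prod>k\<in>{1..2 * int n}. f k) = (\<Prod>k\<in>{1..int n}. f k)\<^sup>2"
proof -
  have "{1..2 * int n} = {1..int n} \<union> {int n + 1..2 * int n}" by auto
  then have "(\<Prod>k\<in>{1..2 * int n}. f k) = (\<Prod>k\<in>{1..int n}. f k) * (\<Prod>k\<in>{int n + 1..2 * int n}. f k)"
    by (simp add: prod.union_disjoint)
  also have "(\<Prod>k\<in>{int n + 1..2 * int n}. f k) = (\<Prod>k\<in>{1..int n}. f k)"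
  proof (rule prod.reindex_bij_witness[of _ "\<lambda>k. 2 * int n + 1 - k" "\<lambda>k. 2 * int n + 1 - k"])
    fix k assume k: "k \<in> {int n + 1..2 * int n}"
    then have "2 * int n + 1 - k \<in> {1..int n}" by auto
    from assms[OF this] show "f (2 * int n + 1 - k) = f k" by simp
  qed auto
  finally show ?thesis by (simp add: power2_eq_square)
qed

definition pairs :: "nat \<Rightarrow> (int \<times> int) set" where
  "pairs n = {(s, s'). 1 \<le> s \<and> s < s' \<and> s' \<le> int n}"

lemma finite_pairs [simp]: "finite (pairs n)"
  by (rule finite_subset[of _ "{1..int n} \<times> {1..int n}"]) (auto simp: pairs_def)

text \<open>
  The index pairs \<open>(k, l)\<close> modulo \<open>m\<close> for which neither of \<open>k\<close>, \<open>l\<close>, \<open>k - l\<close>, \<open>k + l\<close> vanishes.  The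
  symmetries \<open>k \<mapsto> -k\<close>, \<open>l \<mapsto> -l\<close> and \<open>(k, l) \<mapsto> (l, k)\<close> act freely on them, with \<open>pairs n\<close>
  as a set of representatives, whence the exponent \<open>8\<close> below.
\<close>
definition generic :: "nat \<Rightarrow> (int \<times> int) set" where
  "generic n = {(k, l). k \<in> {1..2 * int n} \<and> l \<in> {1..2 * int n} \<and> l \<noteq> k \<and> l \<noteq> 2 * int n + 1 - k}"

lemma finite_generic [simp]: "finite (generic n)"
  by (rule finite_subset[of _ "{1..2 * int n} \<times> {1..2 * int n}"]) (auto simp: generic_def)

lemma prod_square_pairs:
  fixes F :: "int \<Rightarrow> int \<Rightarrow> 'a :: comm_monoid_mult"
  assumes "\<And>k l. F k l = F l k"
  shows "(\<Prod>k\<in>{1..int n}. \<Prod>l\<in>{1..int n}. if l = k then 1 else F k l) = (\<Prod>(k, l)\<in>pairs n. F k l)\<^sup>2"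
proof -
  let ?g = "\<lambda>(k, l). if l = k then 1 else F k l"
  let ?D = "{(k, l). k \<in> {1..int n} \<and> l = k}"
  have split: "{1..int n} \<times> {1..int n} = ?D \<union> (pairs n \<union> prod.swap ` pairs n)"
  proof (intro equalityI subsetI)
    fix p assume "p \<in> {1..int n} \<times> {1..int n}"
    then obtain k l where p: "p = (k, l)" "k \<in> {1..int n}" "l \<in> {1..int n}" by auto
    consider "k = l" | "k < l" | "l < k" by linarith
    then show "p \<in> ?D \<union> (pairs n \<union> prod.swap ` pairs n)"
      using p by cases (force simp: pairs_def)+
  qed (auto simp: pairs_def)
  have fin: "finite ?D" by (rule finite_subset[of _ "{1..int n} \<times> {1..int n}"]) auto
  have "(\<Prod>k\<in>{1..int n}. \<Prod>l\<in>{1..int n}. if l = k then 1 else F k l) = prod ?g ({1..int n} \<times> {1..int n})"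
    by (simp add: prod.cartesian_product)
  also have "\<dots> = prod ?g ?D * (prod ?g (pairs n) * prod ?g (prod.swap ` pairs n))"
  proof -
    have "pairs n \<inter> prod.swap ` pairs n = {}" "?D \<inter> (pairs n \<union> prod.swap ` pairs n) = {}"
      by (auto simp: pairs_def)
    then show ?thesis unfolding split using fin by (simp add: prod.union_disjoint)
  qed
  also have "prod ?g ?D = 1" by (rule prod.neutral) auto
  also have "prod ?g (pairs n) = (\<Prod>(k, l)\<in>pairs n. F k l)"
    by (intro prod.cong refl) (auto simp: pairs_def)
  also have "prod ?g (prod.swap ` pairs n) = (\<Prod>(k, l)\<in>pairs n. F k l)"
    by (subst prod.reindex) (auto intro!: prod.cong simp: pairs_def assms[of "snd _"] intro: assms)
  finally show ?thesis by (simp add: power2_eq_square)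
qed

lemma prod_generic:
  fixes F :: "int \<Rightarrow> int \<Rightarrow> real"
  assumes sym: "\<And>k l. F k l = F l k" and even: "\<And>k l. F (2 * int n + 1 - k) l = F k l"
  shows "(\<Prod>(k, l)\<in>generic n. F k l) = (\<Prod>(k, l)\<in>pairs n. F k l) ^ 8"
proof -
  let ?I = "{1..2 * int n}" and ?m = "2 * int n + 1"
  define G where "G k l = (if l = k \<or> l = ?m - k then 1 else F k l)" for k l
  have even2: "F k (?m - l) = F k l" for k l using sym even by metis
  have "(\<Prod>(k, l)\<in>generic n. F k l) = (\<Prod>(k, l)\<in>?I \<times> ?I. G k l)"
  proof (rule prod.mono_neutral_cong_left)
    show "\<forall>i\<in>?I \<times> ?I - generic n. (case i of (k, l) \<Rightarrow> G k l) = 1"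
      by (auto simp: generic_def G_def)
  qed (auto simp: generic_def G_def)
  also have "\<dots> = (\<Prod>k\<in>?I. \<Prod>l\<in>?I. G k l)"
    by (simp add: prod.cartesian_product)
  also have "\<dots> = (\<Prod>k\<in>?I. (\<Prod>l\<in>{1..int n}. G k l)\<^sup>2)"
    by (intro prod.cong refl prod_fold) (auto simp: G_def even2)
  also have "\<dots> = (\<Prod>k\<in>{1..int n}. (\<Prod>l\<in>{1..int n}. G k l)\<^sup>2)\<^sup>2"
  proof (rule prod_fold)
    fix k
    have "G (?m - k) l = G k l" for l by (auto simp: G_def even)
    then show "(\<Prod>l\<in>{1..int n}. G (?m - k) l)\<^sup>2 = (\<Prod>l\<in>{1..int n}. G k l)\<^sup>2" by simp
  qed
  also have "\<dots> = (\<Prod>k\<in>{1..int n}. \<Prod>l\<in>{1..int n}. G k l) ^ 4"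
    unfolding prod_power_distrib by (simp flip: power_mult)
  also have "(\<Prod>k\<in>{1..int n}. \<Prod>l\<in>{1..int n}. G k l) =
      (\<Prod>k\<in>{1..int n}. \<Prod>l\<in>{1..int n}. if l = k then 1 else F k l)"
    by (intro prod.cong refl) (auto simp: G_def)
  also have "\<dots> = (\<Prod>(k, l)\<in>pairs n. F k l)\<^sup>2"
    by (rule prod_square_pairs) (rule sym)
  finally show ?thesis by (simp flip: power_mult)
qed


lemma cos_squared_half_angle_mod:
  "(cos (half_angle n (k mod (2 * int n + 1))))\<^sup>2 = (cos (half_angle n k))\<^sup>2"
proof -
  define j where "j = k div (2 * int n + 1)"
  have "half_angle n k = half_angle n (k mod (2 * int n + 1) + j * (2 * int n + 1))"
    unfolding j_def by (simp only: mod_div_mult_eq)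
  also have "half_angle n (j * (2 * int n + 1)) = of_int j * pi"
  proof -
    have "2 * real n + 1 \<noteq> 0" by linarith
    then show ?thesis by (simp add: half_angle_def field_simps)
  qed
  then have "half_angle n (k mod (2 * int n + 1) + j * (2 * int n + 1)) =
      half_angle n (k mod (2 * int n + 1)) + of_int j * pi"
    by (simp only: half_angle_add)
  finally have "half_angle n k = half_angle n (k mod (2 * int n + 1)) + of_int j * pi" .
  moreover have "(cos (of_int j * pi))\<^sup>2 = 1"
    using sin_cos_squared_add[of "of_int j * pi"] by (simp add: sin_npi_int mult.commute[of _ pi])
  ultimately show ?thesis
    by (simp add: cos_add power_mult_distrib sin_npi_int mult.commute[of _ pi])
qed

lemma mod_in_generic_iff:
  assumes m: "m = 2 * int n + 1"
  shows "(a mod m, b mod m) \<in> generic n \<longleftrightarrow> \<not> m dvd a \<and> \<not> m dvd b \<and> \<not> m dvd (a - b) \<and> \<not> m dvd (a + b)"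
proof -
  define r s where "r = a mod m" and "s = b mod m"
  have "m > 0" using m by simp
  then have rs: "0 \<le> r" "r < m" "0 \<le> s" "s < m" by (simp_all add: r_def s_def)
  have "m dvd a \<longleftrightarrow> r = 0" "m dvd b \<longleftrightarrow> s = 0" by (auto simp: r_def s_def dvd_eq_mod_eq_0)
  moreover have "m dvd (a - b) \<longleftrightarrow> r = s" by (simp add: r_def s_def mod_eq_dvd_iff)
  moreover have "m dvd (a + b) \<longleftrightarrow> s = m - r \<or> r = 0 \<and> s = 0"
  proof -
    have "m dvd (a + b) \<longleftrightarrow> (r + s) mod m = 0" by (simp add: r_def s_def mod_add_eq dvd_eq_mod_eq_0)
    also have "\<dots> \<longleftrightarrow> s = m - r \<or> r = 0 \<and> s = 0"
    proof (cases "r + s < m")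
      case False
      then have "(r + s) mod m = (r + s - m) mod m" by simp
      also have "\<dots> = r + s - m" using False rs by (intro mod_pos_pos_trivial) auto
      finally show ?thesis using False rs by auto
    qed (use rs in auto)
    finally show ?thesis .
  qed
  ultimately show ?thesis
    using rs m unfolding r_def[symmetric] s_def[symmetric] by (auto simp: generic_def)
qed

lemma generic_mod:
  assumes "(k, l) \<in> generic n"
  shows "k mod (2 * int n + 1) = k" "l mod (2 * int n + 1) = l"
  using assms by (auto simp: generic_def)

lemma dvd_double_iff:
  assumes "m = 2 * int n + 1"
  shows "m dvd 2 * x \<longleftrightarrow> m dvd x"
proof -
  have "coprime m 2" using assms by simp
  then show ?thesis by (rule coprime_dvd_mult_right_iff)
qed

lemma generic_dvd:
  assumes "(k, l) \<in> generic n" and m: "m = 2 * int n + 1"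
  shows "\<not> m dvd k" "\<not> m dvd l" "\<not> m dvd (k - l)" "\<not> m dvd (k + l)"
  using mod_in_generic_iff[OF m, of k l] generic_mod[OF assms(1)] assms by auto

lemma bij_generic_double:
  assumes m: "m = 2 * int n + 1"
  shows "bij_betw (\<lambda>(k, l). (2 * k mod m, 2 * l mod m)) (generic n) (generic n)"
proof -
  let ?f = "\<lambda>(k, l). (2 * k mod m, 2 * l mod m)"
  have inj: "inj_on ?f (generic n)"
  proof (rule inj_onI)
    fix p p' assume *: "p \<in> generic n" "p' \<in> generic n" "?f p = ?f p'"
    obtain k l k' l' where p: "p = (k, l)" "p' = (k', l')" by (metis surj_pair)
    have "m dvd 2 * (k - k')" "m dvd 2 * (l - l')"
      using * p by (auto simp: mod_eq_dvd_iff right_diff_distrib)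
    then have "k mod m = k' mod m" "l mod m = l' mod m"
      unfolding dvd_double_iff[OF m] mod_eq_dvd_iff by auto
    then show "p = p'" using generic_mod[of k l n] generic_mod[of k' l' n] * p m by simp
  qed
  have sub: "?f ` generic n \<subseteq> generic n"
  proof clarify
    fix k l assume "(k, l) \<in> generic n"
    note d = generic_dvd[OF this m]
    have "\<not> m dvd (2 * k - 2 * l)" "\<not> m dvd (2 * k + 2 * l)"
      using d dvd_double_iff[OF m, of "k - l"] dvd_double_iff[OF m, of "k + l"]
      by (simp_all add: algebra_simps)
    then show "(2 * k mod m, 2 * l mod m) \<in> generic n"
      unfolding mod_in_generic_iff[OF m] dvd_double_iff[OF m] using d by blast
  qed
  show ?thesis
    unfolding bij_betw_def by (intro conjI inj endo_inj_surj[OF finite_generic sub])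
qed

text \<open>
  Sum and difference of the new pair are \<open>2 k\<close> and \<open>2 l\<close>; as \<open>2\<close> is invertible modulo \<open>m\<close>, the map is
  injective and preserves the conditions on generic pairs.
\<close>
lemma bij_generic_rotate:
  assumes m: "m = 2 * int n + 1"
  shows "bij_betw (\<lambda>(k, l). ((k + l) mod m, (k - l) mod m)) (generic n) (generic n)"
proof -
  let ?f = "\<lambda>(k, l). ((k + l) mod m, (k - l) mod m)"
  have inj: "inj_on ?f (generic n)"
  proof (rule inj_onI)
    fix p p' assume *: "p \<in> generic n" "p' \<in> generic n" "?f p = ?f p'"
    obtain k l k' l' where p: "p = (k, l)" "p' = (k', l')" by (metis surj_pair)
    have d: "m dvd (k + l) - (k' + l')" "m dvd (k - l) - (k' - l')"
      using * p by (auto simp: mod_eq_dvd_iff)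
    have "m dvd 2 * (k - k')" "m dvd 2 * (l - l')"
      using dvd_add[OF d] dvd_diff[OF d] by (simp_all add: algebra_simps)
    then have "k mod m = k' mod m" "l mod m = l' mod m"
      unfolding dvd_double_iff[OF m] mod_eq_dvd_iff by auto
    then show "p = p'" using generic_mod[of k l n] generic_mod[of k' l' n] * p m by simp
  qed
  have sub: "?f ` generic n \<subseteq> generic n"
  proof clarify
    fix k l assume "(k, l) \<in> generic n"
    note d = generic_dvd[OF this m]
    have "\<not> m dvd ((k + l) - (k - l))" "\<not> m dvd ((k + l) + (k - l))"
      using d dvd_double_iff[OF m, of l] dvd_double_iff[OF m, of k]
      by (simp_all add: algebra_simps)
    then show "((k + l) mod m, (k - l) mod m) \<in> generic n"
      unfolding mod_in_generic_iff[OF m] using d by blast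
  qed
  show ?thesis
    unfolding bij_betw_def by (intro conjI inj endo_inj_surj[OF finite_generic sub])
qed

lemma sum_cos_squares:
  fixes x y :: real
  shows "4 * (cos (x + y))\<^sup>2 + 4 * (cos (x - y))\<^sup>2 =
    8 * ((cos x)\<^sup>2 * (cos y)\<^sup>2 + (1 - (cos x)\<^sup>2) * (1 - (cos y)\<^sup>2))"
  unfolding sin_squared_eq[symmetric] cos_add cos_diff
  by (simp add: power2_eq_square algebra_simps)

definition tangent_product :: "nat \<Rightarrow> real" where
  "tangent_product n = (\<Prod>(s, s')\<in>pairs n. (1 + tangent n s * tangent n s') / 2)"

lemma tangent_product_pos: "tangent_product n > 0"
  unfolding tangent_product_def
proof (intro prod_pos ballI)
  fix p :: "int \<times> int"
  have "tangent n (fst p) * tangent n (snd p) \<ge> 0"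
    by (simp add: tangent_def)
  then show "0 < (case p of (s, s') \<Rightarrow> (1 + tangent n s * tangent n s') / 2)"
    by (cases p) simp
qed

text \<open>
  The pairs are first doubled and then rotated, so that the sum of two squared cosines becomes
  an expression in the angles \<open>\<pi> (k + l) / m\<close> and \<open>\<pi> (k - l) / m\<close>, which factors through the tangents.
  The factors \<open>\<mu>\<^sub>s \<mu>\<^sub>s'\<close> split off in this way have product \<open>1\<close>.
\<close>
lemma prod_generic_cos:
  "(\<Prod>(k, l)\<in>generic n. 4 * (cos (half_angle n k))\<^sup>2 + 4 * (cos (half_angle n l))\<^sup>2) = tangent_product n ^ 8"
proof -
  define m where "m = 2 * int n + 1"
  define c where "c k = (cos (half_angle n k))\<^sup>2" for k
  define H where "H s s' = 8 * (c s * c s' + (1 - c s) * (1 - c s'))" for s s'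
  have c_mod: "c (k mod m) = c k" for k
    unfolding c_def m_def by (rule cos_squared_half_angle_mod)
  have "(\<Prod>(k, l)\<in>generic n. 4 * c k + 4 * c l) = (\<Prod>(k, l)\<in>generic n. 4 * c (2 * k) + 4 * c (2 * l))"
    using prod.reindex_bij_betw[OF bij_generic_double[OF m_def], of "\<lambda>(k, l). 4 * c k + 4 * c l"]
    by (simp add: case_prod_beta' c_mod)
  also have "\<dots> = (\<Prod>(k, l)\<in>generic n. H (k + l) (k - l))"
  proof (intro prod.cong refl, clarify)
    fix k l
    have "half_angle n (2 * k) = half_angle n (k + l) + half_angle n (k - l)"
      "half_angle n (2 * l) = half_angle n (k + l) - half_angle n (k - l)"
      by (simp_all add: half_angle_add half_angle_diff half_angle_add[of n l l, simplified] half_angle_add[of n k k, simplified])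
    then show "4 * c (2 * k) + 4 * c (2 * l) = H (k + l) (k - l)"
      unfolding c_def H_def by (simp only: sum_cos_squares)
  qed
  also have "\<dots> = (\<Prod>(s, s')\<in>generic n. H s s')"
    using prod.reindex_bij_betw[OF bij_generic_rotate[OF m_def], of "\<lambda>(s, s'). H s s'"]
    by (simp add: case_prod_beta' H_def c_mod)
  also have "\<dots> = (\<Prod>(s, s')\<in>pairs n. H s s') ^ 8"
  proof (rule prod_generic)
    fix k l
    have "half_angle n (2 * int n + 1 - k) = pi - half_angle n k"
      by (simp add: half_angle_def field_simps)
    then have "c (2 * int n + 1 - k) = c k" by (simp add: c_def)
    then show "H (2 * int n + 1 - k) l = H k l" by (simp add: H_def)
  qed (simp add: H_def algebra_simps)
  also have "(\<Prod>(s, s')\<in>pairs n. H s s') =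
      (\<Prod>(s, s')\<in>pairs n. (4 * c s) * (4 * c s')) * tangent_product n"
    unfolding tangent_product_def prod.distrib[symmetric]
  proof (intro prod.cong refl, clarify)
    fix s s' assume "(s, s') \<in> pairs n"
    then have pos: "cos (half_angle n s) > 0" "cos (half_angle n s') > 0"
      by (auto simp: pairs_def intro!: half_angle_sin_cos_pos(2))
    have t: "tangent n u * c u = - (1 - c u)" if "cos (half_angle n u) > 0" for u
      using that by (simp add: tangent_def c_def tan_def power_divide sin_squared_eq)
    have "4 * c s * (4 * c s') * ((1 + tangent n s * tangent n s') / 2) =
        8 * (c s * c s' + (tangent n s * c s) * (tangent n s' * c s'))"
      by (simp add: field_simps)
    also have "\<dots> = H s s'" unfolding t[OF pos(1)] t[OF pos(2)] H_def by (simp add: algebra_simps)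
    finally show "H s s' = 4 * c s * (4 * c s') * ((1 + tangent n s * tangent n s') / 2)" ..
  qed
  also have "(\<Prod>(s, s')\<in>pairs n. (4 * c s) * (4 * c s')) = 1"
  proof -
    let ?P = "\<Prod>(s, s')\<in>pairs n. (4 * c s) * (4 * c s')"
    have p1: "(\<Prod>s\<in>{1..int n}. 4 * c s) = 1" unfolding c_def by (rule prod_cos_squared)
    have "?P\<^sup>2 = (\<Prod>k\<in>{1..int n}. \<Prod>l\<in>{1..int n}. if l = k then 1 else (4 * c k) * (4 * c l))"
      by (rule prod_square_pairs[symmetric]) simp
    moreover have "(\<Prod>k\<in>{1..int n}. \<Prod>l\<in>{1..int n}. if l = k then 1 else (4 * c k) * (4 * c l))
       * (\<Prod>k\<in>{1..int n}. (4 * c k) * (4 * c k)) = (\<Prod>k\<in>{1..int n}. \<Prod>l\<in>{1..int n}. (4 * c k) * (4 * c l))"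
      unfolding prod.distrib[symmetric]
    proof (intro prod.cong refl)
      fix k assume k: "k \<in> {1..int n}"
      show "(\<Prod>l\<in>{1..int n}. if l = k then 1 else (4 * c k) * (4 * c l)) * ((4 * c k) * (4 * c k)) =
        (\<Prod>l\<in>{1..int n}. (4 * c k) * (4 * c l))"
        using k by (simp add: prod.remove[of "{1..int n}" k] mult.commute)
    qed
    moreover have "(\<Prod>k\<in>{1..int n}. (4 * c k) * (4 * c k)) = 1"
      using p1 by (simp only: prod.distrib mult_1)
    moreover have "(\<Prod>k\<in>{1..int n}. \<Prod>l\<in>{1..int n}. (4 * c k) * (4 * c l)) = 1"
    proof -
      have "(\<Prod>l\<in>{1..int n}. (4 * c k) * (4 * c l)) = (4 * c k) ^ n" for k
        unfolding prod.distrib[of "\<lambda>_. 4 * c k"] p1 by simp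
      then show ?thesis by (simp only: prod_power_distrib[symmetric] p1 power_one)
    qed
    ultimately have "?P\<^sup>2 = 1" by simp
    moreover have "?P > 0"
    proof (intro prod_pos ballI)
      fix p assume "p \<in> pairs n"
      then have "c (fst p) > 0" "c (snd p) > 0"
        using half_angle_sin_cos_pos(2)[of "fst p" n] half_angle_sin_cos_pos(2)[of "snd p" n]
        by (auto simp: pairs_def c_def)
      then show "0 < (case p of (s, s') \<Rightarrow> (4 * c s) * (4 * c s'))" by (cases p) simp
    qed
    ultimately show ?thesis by (simp add: power2_eq_1_iff)
  qed
  finally show ?thesis by (simp add: c_def)
qed

text \<open>
  The pairs with \<open>l = k\<close> or \<open>l = m - k\<close> contribute \<open>(2 \<mu>\<^sub>k)\<^sup>2\<close> for each \<open>k\<close>, which amounts to \<open>2\<^sup>4\<^sup>n\<close>;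
  the generic pairs contribute an eighth power.  The fourth root of the product is then determined by
  positivity.
\<close>
theorem B_eq_tangent_product:
  assumes "n > 0"
  shows "B n = tangent_product n"
proof -
  let ?I = "{1..2 * int n}" and ?m = "2 * int n + 1"
  define u where "u k = 4 * (cos (half_angle n k))\<^sup>2" for k
  have u_refl: "u (?m - k) = u k" for k
  proof -
    have "half_angle n (2 * int n + 1 - k) = pi - half_angle n k"
      by (simp add: half_angle_def field_simps)
    then show ?thesis by (simp add: u_def)
  qed
  have bij: "bij_betw int {1..2 * n} ?I"
    by (simp add: bij_betw_def image_int_atLeastAtMost)
  have "real (A n) ^ 4 = (\<Prod>k=1..2 * n. \<Prod>l=1..2 * n. u (int k) + u (int l))"
    unfolding tilings_fourth_power[OF assms] u_def half_angle_def by simp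
  also have "\<dots> = (\<Prod>k\<in>?I. \<Prod>l\<in>?I. u k + u l)"
    unfolding prod.reindex_bij_betw[OF bij, of "\<lambda>l. u _ + u l"]
    by (rule prod.reindex_bij_betw[OF bij])
  also have "\<dots> = (\<Prod>k\<in>?I. (2 * u k)\<^sup>2 * (\<Prod>l\<in>?I. if l \<noteq> k \<and> l \<noteq> ?m - k then u k + u l else 1))"
  proof (intro prod.cong refl)
    fix k assume k: "k \<in> ?I"
    then have k': "?m - k \<in> ?I - {k}" by auto presburger
    have split: "(\<Prod>l\<in>?I. f l) = f k * (f (?m - k) * (\<Prod>l\<in>?I - {k} - {?m - k}. f l))" for f :: "int \<Rightarrow> real"
      using k k' by (simp only: prod.remove[of ?I k] prod.remove[of "?I - {k}" "?m - k"] finite_atLeastAtMost_int finite_Diff)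
    have "(\<Prod>l\<in>?I - {k} - {?m - k}. if l \<noteq> k \<and> l \<noteq> ?m - k then u k + u l else 1) =
        (\<Prod>l\<in>?I - {k} - {?m - k}. u k + u l)"
      by (intro prod.cong refl) auto
    then show "(\<Prod>l\<in>?I. u k + u l) = (2 * u k)\<^sup>2 * (\<Prod>l\<in>?I. if l \<noteq> k \<and> l \<noteq> ?m - k then u k + u l else 1)"
      unfolding split u_refl by (simp add: power2_eq_square)
  qed
  also have "\<dots> = (\<Prod>k\<in>?I. 2 * u k)\<^sup>2 * (\<Prod>k\<in>?I. \<Prod>l\<in>?I. if l \<noteq> k \<and> l \<noteq> ?m - k then u k + u l else 1)"
    unfolding prod_power_distrib by (rule prod.distrib)
  also have "(\<Prod>k\<in>?I. 2 * u k) = 4 ^ n"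
  proof -
    have "(\<Prod>k\<in>?I. 2 * u k) = (\<Prod>k\<in>{1..int n}. 2 * u k)\<^sup>2"
      by (rule prod_fold) (simp add: u_refl)
    also have "(\<Prod>k\<in>{1..int n}. 2 * u k) = 2 ^ n"
      using prod_cos_squared[of n] unfolding u_def prod.distrib[of "\<lambda>_. 2"] by simp
    finally show ?thesis by (simp flip: power_mult add: power_mult[of 2 2] mult.commute[of n])
  qed
  also have "(\<Prod>k\<in>?I. \<Prod>l\<in>?I. if l \<noteq> k \<and> l \<noteq> ?m - k then u k + u l else 1) = (\<Prod>(k, l)\<in>generic n. u k + u l)"
    unfolding prod.cartesian_product
    by (rule prod.mono_neutral_cong_right) (auto simp: generic_def)
  also have "\<dots> = tangent_product n ^ 8"
    unfolding u_def by (rule prod_generic_cos)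
  also have "(4 ^ n)\<^sup>2 * tangent_product n ^ 8 = (2 ^ n * (tangent_product n)\<^sup>2) ^ 4"
  proof -
    have "((4 :: real) ^ n)\<^sup>2 = (2 ^ n) ^ 4"
    proof -
      have "((2 :: real) ^ 2) ^ n = 4 ^ n" by simp
      moreover have "(((2 :: real) ^ 2) ^ n)\<^sup>2 = (2 ^ n) ^ 4"
        unfolding power_mult[symmetric] by (simp add: ac_simps)
      ultimately show ?thesis by (simp only:)
    qed
    then show ?thesis by (simp add: power_mult_distrib flip: power_mult)
  qed
  finally have "real (A n) = 2 ^ n * (tangent_product n)\<^sup>2"
    by (rule power_eq_imp_eq_base) auto
  then show ?thesis
    unfolding B_def using B_ex1 tangent_product_pos[of n] by (intro the1_equality) auto
qed

section \<open>Newton's identities\<close>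

definition power_sum :: "('i \<Rightarrow> 'a :: comm_ring_1) \<Rightarrow> 'i set \<Rightarrow> nat \<Rightarrow> 'a" where
  "power_sum f I k = (\<Sum>i\<in>I. f i ^ k)"

text \<open>
  Induction on the index set: multiplying by a further factor \<open>1 - f x X\<close> changes the coefficients \<open>c\<close>
  into \<open>c'\<close>, and the new summands in the power sums telescope against \<open>c'\<close>.
\<close>
lemma newton_identity:
  fixes f :: "'i \<Rightarrow> 'a :: {comm_ring_1, idom}"
  assumes "finite I"
  shows "of_nat (Suc k) * coeff (\<Prod>i\<in>I. [:1, - f i:]) (Suc k) =
    - (\<Sum>j\<le>k. power_sum f I (Suc j) * coeff (\<Prod>i\<in>I. [:1, - f i:]) (k - j))"
  using assms
proof (induction I arbitrary: k rule: finite_induct)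
  case empty
  then show ?case by (simp add: power_sum_def)
next
  case (insert x I)
  define c where "c = coeff (\<Prod>i\<in>I. [:1, - f i:])"
  define c' where "c' = coeff (\<Prod>i\<in>insert x I. [:1, - f i:])"
  have c'_0: "c' 0 = c 0" and c'_Suc: "c' (Suc j) = c (Suc j) - f x * c j" for j
    using insert by (simp_all add: c_def c'_def mult_pCons_left)
  have tele: "(\<Sum>j\<le>k. f x ^ Suc j * c' (k - j)) = f x * c k" for k
  proof (induction k)
    case (Suc k)
    have "(\<Sum>j\<le>Suc k. f x ^ Suc j * c' (Suc k - j)) =
        f x * c' (Suc k) + f x * (\<Sum>j\<le>k. f x ^ Suc j * c' (k - j))"
      unfolding sum.atMost_Suc_shift by (simp add: sum_distrib_left mult.assoc)
    then show ?case unfolding Suc.IH c'_Suc by (simp add: algebra_simps)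
  qed (simp add: c'_0)
  have conv: "(\<Sum>j\<le>k. s j * c' (k - j)) = (\<Sum>j\<le>k. s j * c (k - j)) - f x * (\<Sum>j<k. s j * c (k - 1 - j))"
    for s :: "nat \<Rightarrow> 'a" and k
  proof (cases k)
    case (Suc k')
    have "(\<Sum>j\<le>k. s j * c' (k - j)) = (\<Sum>j<k. s j * c' (k - j)) + s k * c 0"
      by (simp add: c'_0 flip: lessThan_Suc_atMost)
    also have "(\<Sum>j<k. s j * c' (k - j)) = (\<Sum>j<k. s j * c (k - j) - f x * (s j * c (k - 1 - j)))"
    proof (intro sum.cong refl)
      fix j assume "j \<in> {..<k}"
      then have "k - j = Suc (k - 1 - j)" by simp
      then show "s j * c' (k - j) = s j * c (k - j) - f x * (s j * c (k - 1 - j))"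
        by (simp only: c'_Suc) (simp add: algebra_simps)
    qed
    also have "\<dots> + s k * c 0 = (\<Sum>j\<le>k. s j * c (k - j)) - f x * (\<Sum>j<k. s j * c (k - 1 - j))"
      by (simp add: sum_subtractf sum_distrib_left flip: lessThan_Suc_atMost)
    finally show ?thesis .
  qed (simp add: c'_0)
  have ps: "power_sum f (insert x I) j = f x ^ j + power_sum f I j" for j
    using insert by (simp add: power_sum_def)
  have "(\<Sum>j\<le>k. power_sum f (insert x I) (Suc j) * c' (k - j)) =
      f x * c k + ((\<Sum>j\<le>k. power_sum f I (Suc j) * c (k - j)) - f x * (\<Sum>j<k. power_sum f I (Suc j) * c (k - 1 - j)))"
    unfolding ps distrib_right sum.distrib tele conv ..
  also have "(\<Sum>j\<le>k. power_sum f I (Suc j) * c (k - j)) = - (of_nat (Suc k) * c (Suc k))"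
    using insert.IH[of k] by (simp add: c_def)
  also have "(\<Sum>j<k. power_sum f I (Suc j) * c (k - 1 - j)) = - (of_nat k * c k)"
  proof (cases k)
    case (Suc k')
    then show ?thesis using insert.IH[of k'] by (simp add: c_def lessThan_Suc_atMost)
  qed simp
  finally show ?case unfolding c'_def[symmetric] c'_Suc by (simp add: algebra_simps)
qed

lemma coeff_prod_0: "coeff (\<Prod>i\<in>I. [:1, - f i:]) 0 = (1 :: 'a :: comm_ring_1)"
  by (simp add: poly_prod flip: poly_0_coeff_0)

lemma power_sum_rational:
  fixes f :: "'i \<Rightarrow> real"
  assumes "finite I" "\<And>k. coeff (\<Prod>i\<in>I. [:1, - f i:]) k \<in> \<rat>"
  shows "power_sum f I k \<in> \<rat>"
proof (induction k rule: less_induct)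
  case (less k)
  show ?case
  proof (cases k)
    case 0
    then show ?thesis by (simp add: power_sum_def)
  next
    case (Suc l)
    define c where "c = coeff (\<Prod>i\<in>I. [:1, - f i:])"
    have "power_sum f I (Suc l) = - (of_nat (Suc l) * c (Suc l)) - (\<Sum>j<l. power_sum f I (Suc j) * c (l - j))"
      using newton_identity[OF assms(1), of l f] coeff_prod_0[of f I]
      by (simp add: c_def flip: lessThan_Suc_atMost)
    moreover have "\<dots> \<in> \<rat>"
      using assms(2) less.IH Suc by (intro Rats_diff Rats_minus_iff[THEN iffD2] Rats_mult Rats_of_nat Rats_sum) (auto simp: c_def)
    ultimately show ?thesis using Suc by simp
  qed
qed

lemma coeff_prod_rational:
  fixes f :: "'i \<Rightarrow> real"
  assumes "finite I" "\<And>k. power_sum f I k \<in> \<rat>"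
  shows "coeff (\<Prod>i\<in>I. [:1, - f i:]) k \<in> \<rat>"
proof (induction k rule: less_induct)
  case (less k)
  show ?case
  proof (cases k)
    case 0
    then show ?thesis by (simp add: coeff_prod_0)
  next
    case (Suc l)
    define c where "c = coeff (\<Prod>i\<in>I. [:1, - f i:])"
    have "c (Suc l) = - (\<Sum>j\<le>l. power_sum f I (Suc j) * c (l - j)) / of_nat (Suc l)"
      using newton_identity[OF assms(1), of l f] by (simp add: c_def field_simps)
    moreover have "\<dots> \<in> \<rat>"
      using assms(2) less.IH Suc
      by (intro Rats_divide Rats_minus_iff[THEN iffD2] Rats_mult Rats_of_nat Rats_sum) (auto simp: c_def)
    ultimately show ?thesis using Suc by (simp add: c_def)
  qed
qed

section \<open>Integrality in a cyclotomic ring\<close>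

text \<open>The ring \<open>\<int>[z]\<close>.\<close>

definition root_ring :: "'a :: comm_ring_1 \<Rightarrow> 'a set" where
  "root_ring z = range (\<lambda>p. poly (map_poly of_int p) z)"

lemma root_ring_add: "x \<in> root_ring z \<Longrightarrow> y \<in> root_ring z \<Longrightarrow> x + y \<in> root_ring z"
  unfolding root_ring_def
  by (auto simp: image_iff) (metis of_int_hom.map_poly_hom_add poly_add)

lemma root_ring_mult: "x \<in> root_ring z \<Longrightarrow> y \<in> root_ring z \<Longrightarrow> x * y \<in> root_ring z"
  unfolding root_ring_def
  by (auto simp: image_iff) (metis of_int_poly_hom.hom_mult poly_mult)

lemma root_ring_of_int: "of_int k \<in> root_ring z"
proof -
  have "of_int k = poly (map_poly of_int [:k:]) z" by (simp add: of_int_hom.map_poly_pCons_hom)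
  then show ?thesis unfolding root_ring_def by blast
qed

lemma root_ring_self: "z \<in> root_ring z"
proof -
  have "z = poly (map_poly of_int [:0, 1:]) z" by (simp add: of_int_hom.map_poly_pCons_hom)
  then show ?thesis unfolding root_ring_def by blast
qed

lemma root_ring_power: "x \<in> root_ring z \<Longrightarrow> x ^ k \<in> root_ring z"
  by (induction k) (use root_ring_of_int[of 1 z] in \<open>auto intro: root_ring_mult\<close>)

lemma root_ring_sum: "(\<And>i. i \<in> I \<Longrightarrow> f i \<in> root_ring z) \<Longrightarrow> (\<Sum>i\<in>I. f i) \<in> root_ring z"
  by (induction I rule: infinite_finite_induct)
    (use root_ring_of_int[of 0 z] in \<open>auto intro: root_ring_add\<close>)

text \<open>
  Multiplication by \<open>x\<close> maps each power of the root of unity \<open>z\<close> to an integral combination of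
  \<open>1, z, \<dots>, z\<^sup>m\<^sup>-\<^sup>1\<close>.  Hence \<open>x\<close> is an eigenvalue of an integer matrix, and its characteristic polynomial
  is monic with integral coefficients.
\<close>
lemma root_ring_algebraic_int:
  fixes z :: complex
  assumes z: "z ^ m = 1" "m > 0" and x: "x \<in> root_ring z"
  shows "algebraic_int x"
proof -
  obtain p :: "int poly" where p: "x = poly (map_poly of_int p) z"
    using x unfolding root_ring_def by blast
  have xs: "x = (\<Sum>l\<le>degree p. of_int (coeff p l) * z ^ l)"
    unfolding p by (simp add: poly_altdef)
  have zmod: "z ^ (k mod m) = z ^ k" for k
  proof -
    have "z ^ k = z ^ (m * (k div m) + k mod m)" by simp
    also have "\<dots> = z ^ (k mod m)" unfolding power_add power_mult z(1) by simp
    finally show ?thesis ..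
  qed
  define M where "M = mat m m (\<lambda>(i, j). \<Sum>l\<le>degree p. if (i + l) mod m = j then coeff p l else 0)"
  define v where "v = vec m (\<lambda>j. z ^ j)"
  let ?M = "map_mat of_int M :: complex mat"
  have M: "M \<in> carrier_mat m m" "?M \<in> carrier_mat m m" by (auto simp: M_def)
  have "?M *\<^sub>v v = x \<cdot>\<^sub>v v"
  proof (rule eq_vecI)
    fix i assume "i < dim_vec (x \<cdot>\<^sub>v v)"
    then have i: "i < m" by (simp add: v_def)
    have "(?M *\<^sub>v v) $ i = (\<Sum>j<m. (\<Sum>l\<le>degree p. if (i + l) mod m = j then of_int (coeff p l) else 0) * z ^ j)"
      using i by (simp add: M_def v_def scalar_prod_def atLeast0LessThan if_distrib[of of_int] cong: if_cong)
    also have "\<dots> = (\<Sum>l\<le>degree p. \<Sum>j<m. if (i + l) mod m = j then of_int (coeff p l) * z ^ j else 0)"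
      unfolding sum_distrib_right by (subst sum.swap) (intro sum.cong refl, simp)
    also have "\<dots> = (\<Sum>l\<le>degree p. of_int (coeff p l) * z ^ ((i + l) mod m))"
      using z(2) by (simp add: sum.delta')
    also have "\<dots> = x * z ^ i"
      unfolding xs sum_distrib_right zmod by (simp add: power_add ac_simps)
    finally show "(?M *\<^sub>v v) $ i = (x \<cdot>\<^sub>v v) $ i" using i by (simp add: v_def)
  qed (simp add: M_def v_def)
  moreover have "v \<noteq> 0\<^sub>v m"
  proof
    assume "v = 0\<^sub>v m"
    then have "v $ 0 = 0\<^sub>v m $ 0" by simp
    then show False using z(2) by (simp add: v_def)
  qed
  ultimately have "eigenvalue ?M x"
    unfolding eigenvalue_def eigenvector_def by (intro exI[of _ v]) (auto simp: M_def v_def)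
  then have "poly (char_poly ?M) x = 0" using eigenvalue_root_char_poly[OF M(2)] by simp
  moreover have "char_poly ?M = map_poly of_int (char_poly M)"
    by (rule of_int_hom.char_poly_hom[OF M(1)])
  moreover have "lead_coeff (char_poly M) = 1"
    using degree_monic_char_poly[OF M(1)] by simp
  ultimately show ?thesis unfolding algebraic_int_altdef_ipoly by metis
qed

definition root_of_unity :: "nat \<Rightarrow> complex" where
  "root_of_unity n = cis (2 * pi / real (2 * n + 1))"

definition cyclotomic :: "nat \<Rightarrow> real set" where
  "cyclotomic n = {x. complex_of_real x \<in> root_ring (root_of_unity n)}"

lemma root_of_unity_power: "root_of_unity n ^ (2 * n + 1) = 1"
proof -
  have "real (2 * n + 1) * (2 * pi / real (2 * n + 1)) = 2 * pi" by simp
  then show ?thesis unfolding root_of_unity_def DeMoivre by (simp only: cis_2pi)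
qed

lemma cyclotomic_rational:
  assumes "x \<in> cyclotomic n" "x \<in> \<rat>"
  shows "x \<in> \<int>"
proof -
  have "algebraic_int (complex_of_real x)"
    using assms(1) by (intro root_ring_algebraic_int[OF root_of_unity_power]) (auto simp: cyclotomic_def)
  then have "algebraic_int x" by (simp only: algebraic_int_of_real_iff)
  then show ?thesis using assms(2) rational_algebraic_int_is_int by blast
qed

lemma cyclotomic_add: "x \<in> cyclotomic n \<Longrightarrow> y \<in> cyclotomic n \<Longrightarrow> x + y \<in> cyclotomic n"
  by (simp add: cyclotomic_def root_ring_add)

lemma cyclotomic_mult: "x \<in> cyclotomic n \<Longrightarrow> y \<in> cyclotomic n \<Longrightarrow> x * y \<in> cyclotomic n"
  by (simp add: cyclotomic_def root_ring_mult)

lemma cyclotomic_of_int: "of_int k \<in> cyclotomic n"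
  using root_ring_of_int[of k "root_of_unity n"] by (simp add: cyclotomic_def)

text \<open>
  With \<open>a = \<zeta>\<^sup>s\<close> the number is \<open>1 / (4 cos\<^sup>2 (\<pi> s / m)) = a / (1 + a)\<^sup>2\<close>.  The denominator is a unit: since
  \<open>1 + a + \<dots> + a\<^sup>m\<^sup>-\<^sup>1 = 0\<close> and \<open>a\<^sup>m = 1\<close>, the inverse of \<open>1 + a\<close> is \<open>1 + a\<^sup>2 + a\<^sup>4 + \<dots> + a\<^sup>2\<^sup>n\<close>.
\<close>
lemma cyclotomic_tangent:
  assumes s: "s \<in> {1..int n}"
  shows "(1 - tangent n s) / 4 \<in> cyclotomic n"
proof -
  let ?z = "root_of_unity n" and ?y = "half_angle n s"
  define a where "a = ?z ^ nat s"
  have a: "a = cis (2 * ?y)"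
    using s by (simp add: a_def root_of_unity_def DeMoivre half_angle_def field_simps)
  have "a ^ (2 * n + 1) = (?z ^ (2 * n + 1)) ^ nat s"
    by (simp only: a_def power_mult[symmetric] mult.commute)
  then have am: "a ^ (2 * n + 1) = 1" by (simp only: root_of_unity_power power_one)
  have "sin ?y > 0" "cos ?y > 0" using half_angle_sin_cos_pos[OF s] .
  then have "a \<noteq> 1" by (auto simp: a complex_eq_iff sin_double)
  define g where "g = (\<Sum>k\<le>n. a ^ (2 * k))"
  have "(1 + a) * g = (\<Sum>k\<le>n. a ^ (2 * k) + a ^ (2 * k + 1))"
    by (simp add: g_def sum_distrib_left algebra_simps)
  also have "\<dots> = (\<Sum>k\<le>2 * n + 1. a ^ k)" by (rule sum_pair_up[symmetric])
  also have "\<dots> = (\<Sum>k<2 * n + 1. a ^ k) + 1" by (simp only: am flip: lessThan_Suc_atMost) (simp only: sum.lessThan_Suc am)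
  also have "(\<Sum>k<2 * n + 1. a ^ k) = 0"
    using geometric_sum[OF \<open>a \<noteq> 1\<close>, of "2 * n + 1"] am by simp
  finally have g: "(1 + a) * g = 1" by simp
  have "1 + a = 2 * cos ?y * cis ?y"
    by (simp add: a complex_eq_iff cos_double_cos sin_double power2_eq_square)
  then have "(1 + a)\<^sup>2 = of_real (4 * (cos ?y)\<^sup>2) * a"
    by (simp add: power_mult_distrib a power2_eq_square[of "cis _"] cis_mult)
  moreover have "((1 + a) * g)\<^sup>2 = 1" using g by simp
  ultimately have "of_real (4 * (cos ?y)\<^sup>2) * (a * g\<^sup>2) = 1"
    by (simp only: power_mult_distrib mult.assoc)
  then have "a * g\<^sup>2 = of_real (inverse (4 * (cos ?y)\<^sup>2))"
    by (metis inverse_unique of_real_inverse)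
  also have "inverse (4 * (cos ?y)\<^sup>2) = (1 - tangent n s) / 4"
    using \<open>cos ?y > 0\<close> tan_sec[of ?y] by (simp add: tangent_def power_inverse)
  finally have "of_real ((1 - tangent n s) / 4) = a * g\<^sup>2" ..
  moreover have "a * g\<^sup>2 \<in> root_ring ?z"
    unfolding a_def g_def
    by (intro root_ring_mult root_ring_power root_ring_sum root_ring_self)
  ultimately show ?thesis by (simp add: cyclotomic_def)
qed

lemma cyclotomic_coeff_prod:
  assumes "\<And>i. i \<in> I \<Longrightarrow> f i \<in> cyclotomic n"
  shows "coeff (\<Prod>i\<in>I. [:1, - f i:]) k \<in> cyclotomic n"
  using assms
proof (induction I arbitrary: k rule: infinite_finite_induct)
  case (insert i I)
  have "- f i \<in> cyclotomic n"
    using cyclotomic_mult[OF cyclotomic_of_int[of "- 1"], of "f i" n] insert.prems by simp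
  then have "coeff ([:1, - f i:] * (\<Prod>i\<in>I. [:1, - f i:])) k \<in> cyclotomic n"
    using insert.IH insert.prems
    by (cases k) (auto simp: mult_pCons_left diff_conv_add_uminus simp flip: mult_minus_left simp del: add_uminus_conv_diff intro!: cyclotomic_add cyclotomic_mult)
  then show ?case using insert by simp
qed (use cyclotomic_of_int[of 1 n] cyclotomic_of_int[of 0 n] in \<open>auto simp: coeff_eq_0 coeff_1\<close>)

section \<open>Functions given by polynomials of bounded degree\<close>

definition polynomial_fun :: "nat \<Rightarrow> (nat \<Rightarrow> real) \<Rightarrow> bool" where
  "polynomial_fun d f \<longleftrightarrow> (\<exists>p. degree p \<le> d \<and> (\<forall>n. f n = poly p (real n)))"

lemma polynomial_fun_mono: "polynomial_fun d f \<Longrightarrow> d \<le> d' \<Longrightarrow> polynomial_fun d' f"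
  unfolding polynomial_fun_def by (metis order_trans)

lemma polynomial_fun_linear: "polynomial_fun 1 (\<lambda>n. a * real n + b)"
  unfolding polynomial_fun_def
  by (rule exI[of _ "[:b, a:]"]) (auto simp: algebra_simps)

lemma polynomial_fun_const: "polynomial_fun d (\<lambda>n. a)"
  unfolding polynomial_fun_def
  by (rule exI[of _ "[:a:]"]) auto

lemma polynomial_fun_add:
  "polynomial_fun d f \<Longrightarrow> polynomial_fun d g \<Longrightarrow> polynomial_fun d (\<lambda>n. f n + g n)"
  unfolding polynomial_fun_def using degree_add_le poly_add by metis

lemma polynomial_fun_mult:
  "polynomial_fun d f \<Longrightarrow> polynomial_fun e g \<Longrightarrow> polynomial_fun (d + e) (\<lambda>n. f n * g n)"
  unfolding polynomial_fun_def using degree_mult_le poly_mult by (metis add_mono order_trans)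

lemma polynomial_fun_scale: "polynomial_fun d f \<Longrightarrow> polynomial_fun d (\<lambda>n. a * f n)"
  using polynomial_fun_mult[OF polynomial_fun_const[of 0 a], of d f] by simp

lemma polynomial_fun_diff:
  "polynomial_fun d f \<Longrightarrow> polynomial_fun d g \<Longrightarrow> polynomial_fun d (\<lambda>n. f n - g n)"
  using polynomial_fun_add[of d f "\<lambda>n. - 1 * g n"] polynomial_fun_scale[of d g "- 1"] by simp

lemma polynomial_fun_sum:
  "(\<And>i. i \<in> I \<Longrightarrow> polynomial_fun d (f i)) \<Longrightarrow> polynomial_fun d (\<lambda>n. \<Sum>i\<in>I. f i n)"
  by (induction I rule: infinite_finite_induct)
    (auto intro: polynomial_fun_const polynomial_fun_add)

lemma polynomial_fun_prod:
  assumes "finite I" "\<And>i. i \<in> I \<Longrightarrow> polynomial_fun 1 (f i)"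
  shows "polynomial_fun (card I) (\<lambda>n. \<Prod>i\<in>I. f i n)"
  using assms
proof (induction I rule: finite_induct)
  case (insert i I)
  then show ?case
    using polynomial_fun_mult[of 1 "f i" "card I" "\<lambda>n. \<Prod>i\<in>I. f i n"] by simp
qed (simp add: polynomial_fun_const)

lemma polynomial_fun_progression:
  assumes "polynomial_fun d f"
  shows "polynomial_fun d (\<lambda>k. f (4 * k + r))"
proof -
  obtain p where p: "degree p \<le> d" "\<And>n. f n = poly p (real n)"
    using assms unfolding polynomial_fun_def by blast
  have "degree (pcompose p [:real r, 4:]) \<le> d"
    using degree_pcompose_le[of p "[:real r, 4:]"] p(1) by simp
  moreover have "f (4 * k + r) = poly (pcompose p [:real r, 4:]) (real k)" for k
    by (simp add: p(2) poly_pcompose algebra_simps)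
  ultimately show ?thesis unfolding polynomial_fun_def by blast
qed

text \<open>
  The difference \<open>p (x + 1) - p x\<close> has smaller degree and satisfies the hypothesis for the smaller
  bound, so it is integral at all natural numbers; summation recovers \<open>p\<close>.
\<close>
lemma polynomial_integral:
  fixes p :: "real poly"
  assumes "degree p \<le> d" "\<And>k. k \<le> d \<Longrightarrow> poly p (real k) \<in> \<int>"
  shows "poly p (real k) \<in> \<int>"
  using assms
proof (induction d arbitrary: p k)
  case 0
  then obtain a where "p = [:a:]" using degree_eq_zeroE by auto
  then show ?case using 0(2)[of 0] by simp
next
  case (Suc d)
  define q where "q = pcompose p [:1, 1:] - p"
  have "degree q \<le> d"
  proof (rule degree_le, intro allI impI)
    fix i assume "d < i"
    have deg: "degree (pcompose p [:1, 1:]) = degree p" by simp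
    have lead: "lead_coeff (pcompose p [:1, 1:]) = lead_coeff p"
      by (subst lead_coeff_comp) auto
    from \<open>d < i\<close> consider "i > degree p" | "i = degree p" using Suc.prems(1) by linarith
    then show "coeff q i = 0"
      by cases (use lead deg in \<open>auto simp: q_def coeff_eq_0\<close>)
  qed
  moreover have q: "poly q (real k) = poly p (real (Suc k)) - poly p (real k)" for k
    by (simp add: q_def poly_pcompose)
  moreover have "poly q (real k) \<in> \<int>" if "k \<le> d" for k
    unfolding q using Suc.prems(2)[of k] Suc.prems(2)[of "Suc k"] that by simp
  ultimately have step: "poly q (real k) \<in> \<int>" for k using Suc.IH by blast
  show ?case
  proof (induction k)
    case 0
    then show ?case using Suc.prems(2)[of 0] by simp
  next
    case (Suc k)
    have "poly p (real (Suc k)) = poly q (real k) + poly p (real k)" by (simp only: q)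
    then show ?case using Suc.IH step[of k] by (simp only: Ints_add)
  qed
qed

lemma polynomial_fun_integral:
  assumes "polynomial_fun d f" "\<And>k. k \<le> d \<Longrightarrow> f k \<in> \<int>"
  shows "f k \<in> \<int>"
  using assms polynomial_integral unfolding polynomial_fun_def by metis

section \<open>The coefficients of the expansion in powers of two\<close>

definition tangent_sum :: "nat \<Rightarrow> nat \<Rightarrow> real" where
  "tangent_sum n = power_sum (tangent n) {1..int n}"

lemma coeff_prod_tangents:
  "coeff (\<Prod>s\<in>{1..int n}. [:1, - tangent n s:]) l = real ((2 * n + 1) choose (2 * l))"
proof -
  have "coeff (\<Sum>l\<le>n. monom (real ((2 * n + 1) choose (2 * l))) l) l =
      (\<Sum>j\<le>n. if j = l then real ((2 * n + 1) choose (2 * l)) else 0)"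
    unfolding coeff_sum by (intro sum.cong) auto
  then show ?thesis unfolding prod_tangents by (simp add: sum.delta)
qed

lemma tangent_sum_0: "tangent_sum n 0 = real n"
  by (simp add: tangent_sum_def power_sum_def)

lemma tangent_sum_Suc:
  "tangent_sum n (Suc k) = - (real (Suc k) * real ((2 * n + 1) choose (2 * Suc k))
    + (\<Sum>j<k. tangent_sum n (Suc j) * real ((2 * n + 1) choose (2 * (k - j)))))"
proof -
  have "real (Suc k) * real ((2 * n + 1) choose (2 * Suc k)) =
      - (\<Sum>j\<le>k. tangent_sum n (Suc j) * real ((2 * n + 1) choose (2 * (k - j))))"
    using newton_identity[of "{1..int n}" k "tangent n"]
    unfolding coeff_prod_tangents tangent_sum_def by simp
  then show ?thesis by (simp flip: lessThan_Suc_atMost)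
qed

lemma tangent_sum_rational: "tangent_sum n k \<in> \<rat>"
  unfolding tangent_sum_def by (rule power_sum_rational) (simp_all add: coeff_prod_tangents)

lemma polynomial_fun_choose: "polynomial_fun k (\<lambda>n. real ((2 * n + 1) choose k))"
proof -
  have "real ((2 * n + 1) choose k) = (1 / fact k) * (\<Prod>i\<in>{0..<k}. 2 * real n + (1 - real i))" for n
    by (simp add: binomial_gbinomial gbinomial_prod_rev algebra_simps)
  moreover have "polynomial_fun (card {0..<k}) (\<lambda>n. (1 / fact k) * (\<Prod>i\<in>{0..<k}. 2 * real n + (1 - real i)))"
    by (intro polynomial_fun_scale polynomial_fun_prod polynomial_fun_linear finite_atLeastLessThan)
  ultimately show ?thesis by simp
qed

lemma polynomial_fun_tangent_sum: "k > 0 \<Longrightarrow> polynomial_fun (2 * k) (\<lambda>n. tangent_sum n k)"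
proof (induction k rule: less_induct)
  case (less k)
  then obtain l where l: "k = Suc l" by (cases k) auto
  have "polynomial_fun (2 * k) (\<lambda>n. - 1 * (real (Suc l) * real ((2 * n + 1) choose (2 * Suc l))
    + (\<Sum>j<l. tangent_sum n (Suc j) * real ((2 * n + 1) choose (2 * (l - j))))))"
  proof (intro polynomial_fun_scale polynomial_fun_add polynomial_fun_sum)
    show "polynomial_fun (2 * k) (\<lambda>n. real ((2 * n + 1) choose (2 * Suc l)))"
      unfolding l by (rule polynomial_fun_choose)
    fix j assume j: "j \<in> {..<l}"
    have "polynomial_fun (2 * Suc j + 2 * (l - j)) (\<lambda>n. tangent_sum n (Suc j) * real ((2 * n + 1) choose (2 * (l - j))))"
      using less.IH[of "Suc j"] j l by (intro polynomial_fun_mult polynomial_fun_choose) auto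
    then show "polynomial_fun (2 * k) (\<lambda>n. tangent_sum n (Suc j) * real ((2 * n + 1) choose (2 * (l - j))))"
      by (rule polynomial_fun_mono) (use j l in auto)
  qed
  then show ?case by (simp only: l tangent_sum_Suc[of _ l] mult_minus1)
qed

definition cross_sum :: "nat \<Rightarrow> nat \<Rightarrow> real" where
  "cross_sum n i = (tangent_sum n i)\<^sup>2 - tangent_sum n (2 * i)"

lemma sum_pairs:
  fixes f :: "int \<Rightarrow> real"
  shows "2 * (\<Sum>(s, s')\<in>pairs n. f s * f s') = (\<Sum>s\<in>{1..int n}. f s)\<^sup>2 - (\<Sum>s\<in>{1..int n}. (f s)\<^sup>2)"
proof (induction n)
  case 0
  have "pairs 0 = {}" by (auto simp: pairs_def)
  then show ?case by simp
next
  case (Suc n)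
  have new: "pairs (Suc n) = pairs n \<union> (\<lambda>s. (s, int (Suc n))) ` {1..int n}"
    by (auto simp: pairs_def)
  have range: "{1..int (Suc n)} = insert (int (Suc n)) {1..int n}" by auto
  have "(\<Sum>(s, s')\<in>pairs (Suc n). f s * f s') =
      (\<Sum>(s, s')\<in>pairs n. f s * f s') + (\<Sum>s\<in>{1..int n}. f s) * f (int (Suc n))"
  proof -
    have "pairs n \<inter> (\<lambda>s. (s, int (Suc n))) ` {1..int n} = {}" by (auto simp: pairs_def)
    then show ?thesis unfolding new by (simp add: sum.union_disjoint sum.reindex inj_on_def sum_distrib_right)
  qed
  then show ?case
    using Suc.IH unfolding range by (simp add: algebra_simps power2_eq_square)
qed

definition ratio :: "nat \<Rightarrow> int \<times> int \<Rightarrow> real" where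
  "ratio n = (\<lambda>(s, s'). (1 - tangent n s * tangent n s') / 4)"

definition ratio_sum :: "nat \<Rightarrow> nat \<Rightarrow> real" where
  "ratio_sum n = power_sum (ratio n) (pairs n)"

lemma ratio_sum_eq:
  "ratio_sum n k = (\<Sum>i\<le>k. real (k choose i) * (-1) ^ i * cross_sum n i) / (2 * 4 ^ k)"
proof -
  have cross: "2 * (\<Sum>(s, s')\<in>pairs n. (tangent n s * tangent n s') ^ i) = cross_sum n i" for i
    using sum_pairs[of "\<lambda>s. tangent n s ^ i" n]
    by (simp add: cross_sum_def tangent_sum_def power_sum_def power_mult_distrib mult.commute[of 2] flip: power_mult)
  have "ratio_sum n k = (\<Sum>(s, s')\<in>pairs n. (1 - tangent n s * tangent n s') ^ k / 4 ^ k)"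
    by (simp add: ratio_sum_def power_sum_def ratio_def case_prod_unfold power_divide)
  also have "\<dots> = (\<Sum>(s, s')\<in>pairs n. (\<Sum>i\<le>k. real (k choose i) * (-1) ^ i * (tangent n s * tangent n s') ^ i / 4 ^ k))"
  proof (intro sum.cong refl, clarify)
    fix s s'
    have "(1 - tangent n s * tangent n s') ^ k = (- (tangent n s * tangent n s') + 1) ^ k" by simp
    also have "\<dots> = (\<Sum>i\<le>k. real (k choose i) * (-1) ^ i * (tangent n s * tangent n s') ^ i)"
      unfolding binomial_ring by (intro sum.cong refl) (simp add: power_minus[of "_ * _"])
    finally show "(1 - tangent n s * tangent n s') ^ k / 4 ^ k =
        (\<Sum>i\<le>k. real (k choose i) * (-1) ^ i * (tangent n s * tangent n s') ^ i / 4 ^ k)"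
      by (simp add: sum_divide_distrib)
  qed
  also have "\<dots> = (\<Sum>i\<le>k. \<Sum>(s, s')\<in>pairs n. real (k choose i) * (-1) ^ i * (tangent n s * tangent n s') ^ i / 4 ^ k)"
    by (simp only: case_prod_unfold) (rule sum.swap)
  also have "\<dots> = (\<Sum>i\<le>k. real (k choose i) * (-1) ^ i * cross_sum n i / (2 * 4 ^ k))"
    unfolding cross[symmetric] by (intro sum.cong refl) (simp add: sum_distrib_left case_prod_unfold sum_divide_distrib mult.assoc)
  finally show ?thesis by (simp add: sum_divide_distrib)
qed

definition ratio_poly :: "nat \<Rightarrow> real poly" where
  "ratio_poly n = (\<Prod>p\<in>pairs n. [:1, - ratio n p:])"

lemma tangent_product_eq_poly: "tangent_product n = poly (ratio_poly n) 2"
  unfolding tangent_product_def ratio_poly_def poly_prod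
  by (intro prod.cong refl) (auto simp: ratio_def field_simps)

text \<open>
  With \<open>x = (1 - t\<^sub>s) / 4\<close> and \<open>y = (1 - t\<^sub>s') / 4\<close> the ratio is \<open>x + y - 4 x y\<close>, an element of the
  cyclotomic ring.  The coefficients are rational by Newton's identities, first for the tangents
  and then for the ratios.
\<close>
lemma ratio_poly_coeff_integral: "coeff (ratio_poly n) k \<in> \<int>"
proof (rule cyclotomic_rational)
  have "ratio n p \<in> cyclotomic n" if mem: "p \<in> pairs n" for p
  proof -
    obtain s s' where p: "p = (s, s')" "s \<in> {1..int n}" "s' \<in> {1..int n}"
      using mem by (cases p) (auto simp: pairs_def)
    let ?x = "(1 - tangent n s) / 4" and ?y = "(1 - tangent n s') / 4"
    have "ratio n p = ?x + ?y + of_int (- 4) * (?x * ?y)"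
      by (simp add: ratio_def p(1) field_simps)
    then show ?thesis
      by (simp only:) (intro cyclotomic_add cyclotomic_mult cyclotomic_of_int cyclotomic_tangent p)
  qed
  then show "coeff (ratio_poly n) k \<in> cyclotomic n"
    unfolding ratio_poly_def by (rule cyclotomic_coeff_prod)
  have "ratio_sum n j \<in> \<rat>" for j
    unfolding ratio_sum_eq cross_sum_def
    by (intro Rats_divide Rats_sum Rats_mult Rats_diff Rats_power tangent_sum_rational) auto
  then show "coeff (ratio_poly n) k \<in> \<rat>"
    unfolding ratio_poly_def ratio_sum_def by (intro coeff_prod_rational) auto
qed

lemma ratio_poly_coeff_0: "coeff (ratio_poly n) 0 = 1"
  unfolding ratio_poly_def by (rule coeff_prod_0)

lemma ratio_poly_coeff_Suc:
  "coeff (ratio_poly n) (Suc k) =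
    - (\<Sum>j\<le>k. ratio_sum n (Suc j) * coeff (ratio_poly n) (k - j)) / real (Suc k)"
  using newton_identity[of "pairs n" k "ratio n"]
  unfolding ratio_poly_def ratio_sum_def by (simp add: field_simps del: of_nat_Suc)

lemma polynomial_fun_cross_sum:
  assumes "i \<le> k" "k > 0"
  shows "polynomial_fun (4 * k) (\<lambda>n. cross_sum n i)"
proof (cases "i = 0")
  case True
  have "polynomial_fun (1 + 1) (\<lambda>n. (1 * real n + 0) * (1 * real n + 0))"
    by (intro polynomial_fun_mult polynomial_fun_linear)
  then have "polynomial_fun (4 * k) (\<lambda>n. (1 * real n + 0) * (1 * real n + 0))"
    by (rule polynomial_fun_mono) (use assms in auto)
  moreover have "polynomial_fun (4 * k) (\<lambda>n. 1 * real n + 0)"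
    by (rule polynomial_fun_mono[OF polynomial_fun_linear]) (use assms in auto)
  ultimately have "polynomial_fun (4 * k) (\<lambda>n. (1 * real n + 0) * (1 * real n + 0) - (1 * real n + 0))"
    by (rule polynomial_fun_diff)
  then show ?thesis using True by (simp add: cross_sum_def tangent_sum_0 power2_eq_square)
next
  case False
  have "polynomial_fun (2 * i + 2 * i) (\<lambda>n. tangent_sum n i * tangent_sum n i)"
    using False by (intro polynomial_fun_mult polynomial_fun_tangent_sum) auto
  then have "polynomial_fun (4 * k) (\<lambda>n. tangent_sum n i * tangent_sum n i)"
    by (rule polynomial_fun_mono) (use assms in auto)
  moreover have "polynomial_fun (4 * k) (\<lambda>n. tangent_sum n (2 * i))"
    by (rule polynomial_fun_mono[OF polynomial_fun_tangent_sum]) (use assms False in auto)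
  ultimately show ?thesis unfolding cross_sum_def power2_eq_square by (rule polynomial_fun_diff)
qed

lemma polynomial_fun_ratio_sum:
  assumes "k > 0"
  shows "polynomial_fun (4 * k) (\<lambda>n. ratio_sum n k)"
proof -
  have "polynomial_fun (4 * k) (\<lambda>n. (1 / (2 * 4 ^ k)) *
      (\<Sum>i\<le>k. (real (k choose i) * (-1) ^ i) * cross_sum n i))"
    using assms by (intro polynomial_fun_scale polynomial_fun_sum polynomial_fun_cross_sum) auto
  then show ?thesis by (simp add: ratio_sum_eq)
qed

lemma polynomial_fun_ratio_poly_coeff: "polynomial_fun (4 * k) (\<lambda>n. coeff (ratio_poly n) k)"
proof (induction k rule: less_induct)
  case (less k)
  show ?case
  proof (cases k)
    case 0
    then show ?thesis by (simp add: ratio_poly_coeff_0 polynomial_fun_const)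
  next
    case (Suc l)
    have "polynomial_fun (4 * k) (\<lambda>n. (- 1 / real (Suc l)) *
        (\<Sum>j\<le>l. ratio_sum n (Suc j) * coeff (ratio_poly n) (l - j)))"
    proof (intro polynomial_fun_scale polynomial_fun_sum)
      fix j assume j: "j \<in> {..l}"
      have "polynomial_fun (4 * Suc j + 4 * (l - j)) (\<lambda>n. ratio_sum n (Suc j) * coeff (ratio_poly n) (l - j))"
        using less.IH[of "l - j"] Suc by (intro polynomial_fun_mult polynomial_fun_ratio_sum) auto
      then show "polynomial_fun (4 * k) (\<lambda>n. ratio_sum n (Suc j) * coeff (ratio_poly n) (l - j))"
        by (rule polynomial_fun_mono) (use j Suc in auto)
    qed
    then show ?thesis unfolding Suc ratio_poly_coeff_Suc by simp
  qed
qed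

definition truncation :: "nat \<Rightarrow> real" where
  "truncation n = (\<Sum>k<5. coeff (ratio_poly n) k * 2 ^ k)"

lemma polynomial_fun_truncation: "polynomial_fun 16 truncation"
proof -
  have "polynomial_fun 16 (\<lambda>n. \<Sum>k<5. 2 ^ k * coeff (ratio_poly n) k)"
    by (intro polynomial_fun_sum polynomial_fun_scale
        polynomial_fun_mono[OF polynomial_fun_ratio_poly_coeff]) auto
  then show ?thesis unfolding truncation_def[abs_def] by (simp add: mult.commute)
qed

lemma poly_2_truncate:
  fixes p :: "real poly"
  assumes "\<And>k. coeff p k \<in> \<int>"
  shows "\<exists>z\<in>\<int>. poly p 2 = (\<Sum>k<N. coeff p k * 2 ^ k) + 2 ^ N * z"
  using assms
proof (induction N arbitrary: p)
  case 0
  have "poly p 2 \<in> \<int>" unfolding poly_altdef using 0 by (intro Ints_sum Ints_mult) auto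
  then show ?case by auto
next
  case (Suc N)
  obtain a q where p: "p = pCons a q" by (cases p) auto
  have "coeff q k \<in> \<int>" for k using Suc.prems[of "Suc k"] p by simp
  then obtain z where z: "z \<in> \<int>" "poly q 2 = (\<Sum>k<N. coeff q k * 2 ^ k) + 2 ^ N * z"
    using Suc.IH[of q] by blast
  have "poly p 2 = (\<Sum>k<Suc N. coeff p k * 2 ^ k) + 2 ^ Suc N * z"
    unfolding sum.lessThan_Suc_shift by (simp add: p z(2) algebra_simps sum_distrib_left)
  then show ?case using z(1) by blast
qed

section \<open>The computation for small arguments\<close>

text \<open>
  The truncation is computed from the binomial coefficients in integer arithmetic.  For a list starting
  at \<open>x = C(m, j)\<close> this function yields \<open>C(m, j), C(m, j + 2), \<dots>\<close>.
\<close>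

primrec even_binomials :: "int \<Rightarrow> int \<Rightarrow> int \<Rightarrow> nat \<Rightarrow> int list" where
  "even_binomials m j x 0 = []"
| "even_binomials m j x (Suc k) =
    x # even_binomials m (j + 2) (x * ((m - j) * (m - j - 1)) div ((j + 1) * (j + 2))) k"

text \<open>
  The list \<open>s\<close> holds the power sums found so far, the latest first, so that pairing it with the
  coefficients \<open>d\<close> gives the convolution in Newton's identity.
\<close>
definition newton_next :: "int list \<Rightarrow> int list \<Rightarrow> int list" where
  "newton_next d s = - (int (Suc (length s)) * d ! length s + sum_list (map2 (*) s d)) # s"

primrec newton_sums :: "int list \<Rightarrow> nat \<Rightarrow> int list" where
  "newton_sums d 0 = []"
| "newton_sums d (Suc k) = newton_next d (newton_sums d k)"

text \<open>
  Let \<open>w\<^sub>i = (\<Sum> t\<^sub>s\<^sup>i)\<^sup>2 - \<Sum> t\<^sub>s\<^sup>2\<^sup>i\<close> be twice the \<open>i\<close>-th power sum of the products \<open>t\<^sub>s t\<^sub>s'\<close>, and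
  \<open>q\<^sub>k = 2 \<cdot> 4\<^sup>k\<close> times the \<open>k\<close>-th power sum of the ratios.  Solving Newton's identities for
  \<open>c\<^sub>1, \<dots>, c\<^sub>4\<close> in terms of \<open>q\<^sub>1, \<dots>, q\<^sub>4\<close> and clearing denominators gives the formula below for
  \<open>6144\<close> times the truncation.  Each stage is a function of its own so that the arguments
  are reduced to numerals before they are used several times.
\<close>
definition from_ratio_sums :: "int \<Rightarrow> int \<Rightarrow> int \<Rightarrow> int \<Rightarrow> int" where
  "from_ratio_sums q1 q2 q3 q4 = 6144 - 1536 * q1 + 192 * (q1 ^ 2 - 2 * q2)
     - 16 * (q1 ^ 3 - 6 * q1 * q2 + 8 * q3)
     + (q1 ^ 4 - 12 * q1 ^ 2 * q2 + 12 * q2 ^ 2 + 32 * q1 * q3 - 48 * q4)"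

definition from_cross_sums :: "int \<Rightarrow> int \<Rightarrow> int \<Rightarrow> int \<Rightarrow> int \<Rightarrow> int" where
  "from_cross_sums w0 w1 w2 w3 w4 = from_ratio_sums (w0 - w1) (w0 - 2 * w1 + w2)
     (w0 - 3 * w1 + 3 * w2 - w3) (w0 - 4 * w1 + 6 * w2 - 4 * w3 + w4)"

fun from_tangent_sums :: "int \<Rightarrow> int list \<Rightarrow> int" where
  "from_tangent_sums n [t8, t7, t6, t5, t4, t3, t2, t1] =
     from_cross_sums (n ^ 2 - n) (t1 ^ 2 - t2) (t2 ^ 2 - t4) (t3 ^ 2 - t6) (t4 ^ 2 - t8)"

definition scaled_truncation :: "int \<Rightarrow> int" where
  "scaled_truncation n = from_tangent_sums n (newton_sums (tl (even_binomials (2 * n + 1) 0 1 9)) 8)"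

definition target :: "int \<Rightarrow> int" where
  "target n = (if n mod 2 = 0 then n + 1 else if n mod 4 = 1 then n else - n)"

text \<open>The modulus is \<open>32 \<cdot> 6144\<close>.\<close>
definition congruent_target :: "int \<Rightarrow> bool" where
  "congruent_target n \<longleftrightarrow> (scaled_truncation n - 6144 * target n) mod 196608 = 0"

lemma congruent_target_0_67: "list_all congruent_target [0..67]"
  by code_simp

lemma scaled_truncation_3: "scaled_truncation 3 = 6144 * 29"
  by code_simp

lemma even_binomials_eq:
  "even_binomials (int m) (int j) (int (m choose j)) k = map (\<lambda>i. int (m choose (j + 2 * i))) [0..<k]"
proof (induction k arbitrary: j)
  case (Suc k)
  have absorb: "int (Suc i) * int (m choose Suc i) = (int m - int i) * int (m choose i)" for i
  proof (cases "i \<le> m")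
    case True
    have "Suc i * (m choose Suc i) = (m - i) * (m choose i)"
      by (simp only: binomial_absorption binomial_absorb_comp)
    then have "int (Suc i * (m choose Suc i)) = int ((m - i) * (m choose i))" by (simp only:)
    then show ?thesis using True by (simp only: of_nat_mult of_nat_diff)
  qed (simp add: binomial_eq_0)
  have "int (m choose j) * ((int m - int j) * (int m - int j - 1)) =
      ((int m - int j) * int (m choose j)) * (int m - int (Suc j))"
    by (simp add: algebra_simps)
  also have "\<dots> = int (Suc j) * ((int m - int (Suc j)) * int (m choose Suc j))"
    unfolding absorb[symmetric, of j] by (simp only: ac_simps)
  also have "\<dots> = ((int j + 1) * (int j + 2)) * int (m choose (j + 2))"
    unfolding absorb[symmetric, of "Suc j"] by (simp add: algebra_simps)
  finally have "int (m choose j) * ((int m - int j) * (int m - int j - 1)) div ((int j + 1) * (int j + 2)) =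
      int (m choose (j + 2))" by simp
  then have "even_binomials (int m) (int j) (int (m choose j)) (Suc k) =
      int (m choose j) # map (\<lambda>i. int (m choose (j + 2 + 2 * i))) [0..<k]"
    using Suc.IH[of "j + 2"] by (simp add: add.commute[of 2])
  also have "\<dots> = map (\<lambda>i. int (m choose (j + 2 * i))) [0..<Suc k]"
    by (simp add: map_upt_Suc del: upt_Suc)
  finally show ?case .
qed simp

lemma newton_sums_eq:
  assumes d: "\<And>i. i < length d \<Longrightarrow> real_of_int (d ! i) = real ((2 * n + 1) choose (2 * Suc i))"
    and "k \<le> length d"
  shows "length (newton_sums d k) = k \<and>
    (\<forall>i<k. real_of_int (newton_sums d k ! i) = tangent_sum n (k - i))"
  using assms(2)
proof (induction k)
  case (Suc k)
  define s where "s = newton_sums d k"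
  have s: "length s = k" "\<And>i. i < k \<Longrightarrow> real_of_int (s ! i) = tangent_sum n (k - i)"
    using Suc by (auto simp: s_def)
  have "real_of_int (sum_list (map2 (*) s d)) = (\<Sum>i<k. real_of_int (s ! i) * real_of_int (d ! i))"
    using Suc.prems s(1) by (simp add: sum_list_sum_nth atLeast0LessThan)
  also have "\<dots> = (\<Sum>i<k. tangent_sum n (Suc (k - Suc i)) * real ((2 * n + 1) choose (2 * (k - (k - Suc i)))))"
    using Suc.prems by (intro sum.cong refl) (auto simp: s d Suc_diff_Suc)
  also have "\<dots> = (\<Sum>j<k. tangent_sum n (Suc j) * real ((2 * n + 1) choose (2 * (k - j))))"
    by (rule sum.nat_diff_reindex)
  finally have head: "real_of_int (- (int (Suc k) * d ! k + sum_list (map2 (*) s d))) = tangent_sum n (Suc k)"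
    unfolding tangent_sum_Suc[of n k] using d[of k] Suc.prems by simp
  have "newton_sums d (Suc k) = - (int (Suc k) * d ! k + sum_list (map2 (*) s d)) # s"
    by (simp add: newton_next_def s(1) s_def[symmetric])
  then show ?case using s head by (auto simp: nth_Cons' simp del: of_int_minus of_int_add of_int_mult)
qed simp

lemma scaled_truncation_eq: "real_of_int (scaled_truncation (int n)) = 6144 * truncation n"
proof -
  define d where "d = tl (even_binomials (2 * int n + 1) 0 1 9)"
  have *: "even_binomials (2 * int n + 1) 0 1 9 = map (\<lambda>i. int ((2 * n + 1) choose (2 * i))) [0..<9]"
    using even_binomials_eq[of "2 * n + 1" 0 9] by (simp add: add.commute)
  have d: "d = map (\<lambda>i. int ((2 * n + 1) choose (2 * Suc i))) [0..<8]"
  proof -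
    have "[0..<9] = [0..<Suc 8]" by simp
    with * show ?thesis unfolding d_def by (simp only: map_upt_Suc list.sel)
  qed
  define s where "s = newton_sums d 8"
  have "length s = 8 \<and> (\<forall>i<8. real_of_int (s ! i) = tangent_sum n (8 - i))"
    unfolding s_def by (rule newton_sums_eq) (auto simp: d simp del: binomial_Suc_Suc upt_Suc)
  then have len: "length s = Suc (Suc (Suc (Suc (Suc (Suc (Suc (Suc 0)))))))"
    and vals: "\<And>i. i < 8 \<Longrightarrow> real_of_int (s ! i) = tangent_sum n (8 - i)" by auto
  obtain t8 t7 t6 t5 t4 t3 t2 t1 where s_eq: "s = [t8, t7, t6, t5, t4, t3, t2, t1]"
    using len by (auto simp: length_Suc_conv)
  have t: "real_of_int t1 = tangent_sum n 1" "real_of_int t2 = tangent_sum n 2"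
    "real_of_int t3 = tangent_sum n 3" "real_of_int t4 = tangent_sum n 4"
    "real_of_int t6 = tangent_sum n 6" "real_of_int t8 = tangent_sum n 8"
    using vals[of 7] vals[of 6] vals[of 5] vals[of 4] vals[of 2] vals[of 0]
    by (simp_all add: s_eq)
  define w where "w = cross_sum n"
  have w: "real_of_int (int n ^ 2 - int n) = w 0" "real_of_int (t1 ^ 2 - t2) = w 1"
    "real_of_int (t2 ^ 2 - t4) = w 2" "real_of_int (t3 ^ 2 - t6) = w 3"
    "real_of_int (t4 ^ 2 - t8) = w 4"
    by (simp_all add: w_def cross_sum_def t tangent_sum_0)
  define q1 q2 q3 q4 where "q1 = w 0 - w 1" and "q2 = w 0 - 2 * w 1 + w 2"
    and "q3 = w 0 - 3 * w 1 + 3 * w 2 - w 3" and "q4 = w 0 - 4 * w 1 + 6 * w 2 - 4 * w 3 + w 4"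
  have "real_of_int (scaled_truncation (int n)) = 6144 - 1536 * q1 + 192 * (q1 ^ 2 - 2 * q2)
     - 16 * (q1 ^ 3 - 6 * q1 * q2 + 8 * q3)
     + (q1 ^ 4 - 12 * q1 ^ 2 * q2 + 12 * q2 ^ 2 + 32 * q1 * q3 - 48 * q4)"
    unfolding scaled_truncation_def d_def[symmetric] s_def[symmetric] s_eq from_tangent_sums.simps
      from_cross_sums_def from_ratio_sums_def q1_def q2_def q3_def q4_def w[symmetric] by simp
  also have "\<dots> = 6144 * truncation n"
  proof -
    have p: "ratio_sum n 1 = q1 / 8" "ratio_sum n 2 = q2 / 32" "ratio_sum n 3 = q3 / 128" "ratio_sum n 4 = q4 / 512"
      by (simp_all add: ratio_sum_eq w_def[symmetric] q1_def q2_def q3_def q4_def eval_nat_numeral)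
    define c where "c = coeff (ratio_poly n)"
    have c0: "c 0 = 1" by (simp add: c_def ratio_poly_coeff_0)
    have rec: "real (Suc k) * c (Suc k) = - (\<Sum>j\<le>k. ratio_sum n (Suc j) * c (k - j))" for k
      unfolding c_def ratio_poly_coeff_Suc by simp
    have r1: "c 1 = - (ratio_sum n 1 * c 0)"
      using rec[of 0] by simp
    have r2: "2 * c 2 = - (ratio_sum n 1 * c 1 + ratio_sum n 2 * c 0)"
      using rec[of 1] by (simp add: eval_nat_numeral)
    have r3: "3 * c 3 = - (ratio_sum n 1 * c 2 + ratio_sum n 2 * c 1 + ratio_sum n 3 * c 0)"
      using rec[of 2] by (simp add: eval_nat_numeral)
    have r4: "4 * c 4 = - (ratio_sum n 1 * c 3 + ratio_sum n 2 * c 2 + ratio_sum n 3 * c 1 + ratio_sum n 4 * c 0)"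
      using rec[of 3] by (simp add: eval_nat_numeral)
    have c1: "c 1 = - q1 / 8"
      using r1 unfolding p c0 by simp
    have c2: "c 2 = (q1 ^ 2 - 2 * q2) / 128"
      using r2 unfolding p c0 c1 by (simp add: field_simps power2_eq_square)
    have c3: "c 3 = - (q1 ^ 3 - 6 * q1 * q2 + 8 * q3) / 3072"
      using r3 unfolding p c0 c1 c2 by (simp add: field_simps power2_eq_square power3_eq_cube)
    have c4: "c 4 = (q1 ^ 4 - 12 * q1 ^ 2 * q2 + 12 * q2 ^ 2 + 32 * q1 * q3 - 48 * q4) / 98304"
      using r4 unfolding p c0 c1 c2 c3 by (simp add: field_simps power2_eq_square power3_eq_cube power4_eq_xxxx)
    have "truncation n = c 0 + 2 * c 1 + 4 * c 2 + 8 * c 3 + 16 * c 4"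
      by (simp add: truncation_def c_def[symmetric] eval_nat_numeral)
    then show ?thesis unfolding c0 c1 c2 c3 c4 by (simp add: field_simps)
  qed
  finally show ?thesis .
qed

section \<open>The congruences\<close>

text \<open>
  On the class of \<open>r\<close> modulo \<open>4\<close> the quotient is a polynomial in \<open>k\<close> of degree at most \<open>16\<close>, where
  \<open>n = 4 k + r\<close>; the values \<open>k \<le> 16\<close> are among the computed ones.
\<close>

lemma truncation_target:
  "(truncation n - real_of_int (target (int n))) / 32 \<in> \<int>"
proof -
  define r k where "r = n mod 4" and "k = n div 4"
  have n: "n = 4 * k + r" and "r < 4" by (simp_all add: r_def k_def)
  define f where "f k = (truncation (4 * k + r) - real_of_int (target (int (4 * k + r)))) / 32" for k
  have "r \<in> {0, 1, 2, 3}" using \<open>r < 4\<close> by auto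
  have "\<exists>a b. \<forall>k. real_of_int (target (int (4 * k + r))) = a * real k + b"
  proof -
    have mods: "int (4 * k + r) mod 4 = int r" "int (4 * k + r) mod 2 = int r mod 2" for k
      using \<open>r < 4\<close> by (simp_all, presburger+)
    have target: "target (int (4 * k + r)) = (if r mod 2 = 0 then 4 * int k + int r + 1
        else if r = 1 then 4 * int k + 1 else - (4 * int k + int r))" for k
      unfolding target_def mods by (auto simp: zmod_int[of r 2, simplified, symmetric])
    show ?thesis
    proof (cases "r mod 2 = 0")
      case True
      show ?thesis unfolding target
        by (rule exI[of _ 4], rule exI[of _ "real r + 1"]) (use True in simp)
    next
      case False
      show ?thesis
      proof (cases "r = 1")
        case True
        show ?thesis unfolding target
          by (rule exI[of _ 4], rule exI[of _ 1]) (use True in simp)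
      next
        case r: False
        show ?thesis unfolding target
          by (rule exI[of _ "- 4"], rule exI[of _ "- real r"])
            (use False r in simp)
      qed
    qed
  qed
  then obtain a b where ab: "\<And>k. real_of_int (target (int (4 * k + r))) = a * real k + b" by blast
  have "polynomial_fun 16 (\<lambda>k. (1 / 32) * (truncation (4 * k + r) - (a * real k + b)))"
    by (intro polynomial_fun_scale polynomial_fun_diff polynomial_fun_progression
        polynomial_fun_truncation polynomial_fun_mono[OF polynomial_fun_linear]) simp
  then have "polynomial_fun 16 f" unfolding f_def[abs_def] ab by simp
  moreover have "f k \<in> \<int>" if "k \<le> 16" for k
  proof -
    have "int (4 * k + r) \<in> set [0..67]" using that \<open>r < 4\<close> by simp
    then have "congruent_target (int (4 * k + r))"
      using congruent_target_0_67 unfolding list_all_iff by blast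
    then obtain z where "scaled_truncation (int (4 * k + r)) - 6144 * target (int (4 * k + r)) = 196608 * z"
      unfolding congruent_target_def by (metis dvd_eq_mod_eq_0 dvdE)
    then have "real_of_int (scaled_truncation (int (4 * k + r)) - 6144 * target (int (4 * k + r))) =
        real_of_int (196608 * z)" by (simp only:)
    then have "f k = of_int z"
      by (simp add: f_def scaled_truncation_eq del: of_nat_add of_nat_mult)
    then show ?thesis by simp
  qed
  ultimately have "f k \<in> \<int>" by (rule polynomial_fun_integral)
  then show ?thesis by (simp only: f_def n)
qed

theorem B_congruence:
  assumes "n > 0"
  shows "\<exists>b. real_of_int b = B n \<and> [b = target (int n)] (mod 32)"
proof -
  obtain z where z: "z \<in> \<int>" "poly (ratio_poly n) 2 = (\<Sum>k<5. coeff (ratio_poly n) k * 2 ^ k) + 2 ^ 5 * z"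
    using poly_2_truncate[OF ratio_poly_coeff_integral] by blast
  have "B n = real_of_int (target (int n)) + 32 * ((truncation n - real_of_int (target (int n))) / 32 + z)"
    using B_eq_tangent_product[OF assms] z(2)
    unfolding tangent_product_eq_poly truncation_def[symmetric] by (simp add: field_simps)
  moreover obtain y where "(truncation n - real_of_int (target (int n))) / 32 + z = of_int y"
    using Ints_add[OF truncation_target[of n] z(1)] by (rule Ints_cases)
  ultimately have "real_of_int (target (int n) + 32 * y) = B n" by simp
  moreover have "[target (int n) + 32 * y = target (int n)] (mod 32)" by (simp add: cong_def)
  ultimately show ?thesis by blast
qed

text \<open>
  For \<open>n = 3\<close> there are only three pairs, so the truncation is the whole polynomial.
\<close>
lemma B_3: "B 3 = 29"
proof -
  have "pairs 3 \<subseteq> {(1, 2), (1, 3), (2, 3)}" by (auto simp: pairs_def)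
  then have "card (pairs 3) \<le> card {(1 :: int, 2 :: int), (1, 3), (2, 3)}" by (intro card_mono) auto
  then have card: "card (pairs 3) \<le> 3" by simp
  have "degree (ratio_poly 3) \<le> (\<Sum>p\<in>pairs 3. degree [:1, - ratio 3 p:])"
    unfolding ratio_poly_def using degree_prod_sum_le[of "pairs 3" "\<lambda>p. [:1, - ratio 3 p:]"] by (simp add: o_def)
  also have "\<dots> \<le> (\<Sum>p\<in>pairs 3. 1)" by (intro sum_mono) simp
  also have "\<dots> \<le> 4" using card by simp
  finally have "degree (ratio_poly 3) \<le> 4" .
  then have "poly (ratio_poly 3) 2 = (\<Sum>k\<le>4. coeff (ratio_poly 3) k * 2 ^ k)"
    unfolding poly_altdef by (intro sum.mono_neutral_left) (auto simp: coeff_eq_0)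
  also have "\<dots> = truncation 3"
    unfolding truncation_def by (rule sum.cong) auto
  finally have "B 3 = truncation 3" by (simp add: B_eq_tangent_product tangent_product_eq_poly)
  then show ?thesis using scaled_truncation_eq[of 3] scaled_truncation_3 by simp
qed

lemma target_eq:
  "target (int n) = (if even n then int n + 1 else (- 1) ^ ((n - 1) div 2) * int n)"
proof (cases "even n")
  case True
  then show ?thesis by (simp add: target_def)
next
  case False
  then obtain k where k: "n = 2 * k + 1" by (elim oddE)
  have "int n mod 4 = 1 \<longleftrightarrow> even k" unfolding k by presburger
  then show ?thesis using False by (simp add: target_def k minus_one_power_iff)
qed

lemma S_mono:
  assumes "S r'" "r \<le> r'"
  shows "S r"
  unfolding S_def
proof (intro allI impI)
  fix n :: nat assume "1 \<le> n"
  then obtain b :: int where b: "real_of_int b = B n"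
    "[b = (if even n then int n + 1 else (- 1) ^ ((n - 1) div 2) * int n)] (mod 2 ^ r')"
    using assms(1) unfolding S_def by blast
  have "(2 :: int) ^ r dvd 2 ^ r'" using assms(2) by (rule le_imp_power_dvd)
  with b show "\<exists>b. real_of_int b = B n \<and>
      [b = (if even n then int n + 1 else (- 1) ^ ((n - 1) div 2) * int n)] (mod 2 ^ r)"
    using cong_dvd_modulus by blast
qed

theorem theoremA:
  shows "S 5 \<and> (\<forall>r\<in>{1, 2, 3, 4}. S r) \<and> \<not> S 6 \<and> (\<forall>r>6. \<not> S r)"
proof -
  have S5: "S 5"
    unfolding S_def target_eq[symmetric] using B_congruence by simp
  have "\<not> S 6"
  proof
    assume "S 6"
    then obtain b :: int where b: "real_of_int b = B 3" "[b = target (int 3)] (mod 2 ^ 6)"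
      unfolding S_def target_eq[symmetric] by (metis one_le_numeral)
    have "b = 29" using b(1) by (simp add: B_3)
    then show False using b(2) by (simp add: target_def cong_def)
  qed
  then show ?thesis using S5 S_mono by (auto intro: less_imp_le)
qed

end
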